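(* For $\gamma \in [\![\Gamma]\!]$: (i) $[\![\Gamma \vdash \bot]\!](\gamma) = \emptyset$; (ii) $[\![\Gamma \vdash A \land B]\!](\gamma) = [\![\Gamma \vdash A]\!](\gamma) \cap [\![\Gamma \vdash B]\!](\gamma)$; (iii) $[\![\Gamma \vdash A \lor B]\!](\gamma) = [\![\Gamma \vdash A]\!](\gamma) \cup [\![\Gamma \vdash B]\!](\gamma)$; (iv) $[\![\Gamma \vdash \exists x:A.Q]\!](\gamma) = \bigcup_{\alpha \in [\![\Gamma \vdash A]\!](\gamma)} [\![\Gamma;(x:A) \vdash Q]\!](\gamma,\alpha)$; (v) if $[\![\Gamma \vdash A \leftrightarrow B]\!](\gamma) = X$ then $[\![\Gamma \vdash A]\!](\gamma) = [\![\Gamma \vdash B]\!](\gamma)$; (vi) if $[\![\Gamma \vdash x =_A y]\!](\gamma) = X$ then $[\![\Gamma \vdash x]\!](\gamma) = [\![\Gamma \vdash y]\!](\gamma)$.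
   Context: Logical symbols are the impredicative encodings in ECC: $A \to B := \forall x:A.B$ ($x$ not free in $B$), $\bot := \forall P:\mathrm{Prop}.P$, $\neg A := A \to \bot$, $A \land B := \forall P:\mathrm{Prop}.(A \to B \to P) \to P$, $A \lor B := \forall P:\mathrm{Prop}.(A \to P) \to (B \to P) \to P$, $\exists x:A.Q := \forall P:\mathrm{Prop}.(\forall x:A.(Q \to P)) \to P$, $A \leftrightarrow B := (A \to B) \land (B \to A)$, $x =_A y := \forall Q:(A \to \mathrm{Prop}).\,Q\,x \leftrightarrow Q\,y$. Model: a topological space $(X,\mathcal{O}(X))$ with reference point $p$ such that $\bigcap\{U \in \mathcal{O}(X) \mid p \in U\}$ is open. $\mathcal{O}(X)$ is a complete Heyting algebra under inclusion: meet of a family $S$ of opens is the interior $(\bigcap S)^\circ$ ($X$ if $S=\emptyset$), binary meet is intersection, joins are unions, exponential $b^a := \bigcup\{t \in \mathcal{O}(X) \mid t \cap a \subseteq b\}$. The interpretation sends $\mathrm{Prop}$ to $\mathcal{O}(X)$, proof terms to $p$; for $\forall x:P.Q$ it gives $([\![\Gamma \vdash Q]\!](\gamma))^{[\![\Gamma \vdash P]\!](\gamma)}$ when $P,Q$ are both propositions (with $x$ not free in $Q$), $\bigl(\bigcap\{[\![\Gamma;(x:P) \vdash Q]\!](\gamma,\alpha) \mid \alpha \in [\![\Gamma \vdash P]\!](\gamma)\}\bigr)^\circ$ (or $X$ if empty) when $P$ is not a proposition but $Q$ is, and the set-theoretic dependent function space over $\alpha \in [\![\Gamma \vdash P]\!](\gamma)$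 (restricted to $\{p\}$ if $P$ is a proposition) otherwise; variables are interpreted by the corresponding component of $\gamma$.
   Formalization: In (iv), A is assumed to be a type that is not a proposition: for a proposition A the clauses give [[A]] ∩ [[Q]], which differs from the stated union (e.g. Sierpinski space with p closed, [[A]] the open point, [[Q]] = X). *)

theory Defs
  imports "HOL-Analysis.Abstract_Topology" "HOL-Library.Monad_Syntax"
begin

section \<open>The ambient set theory\<close>

text \<open>
  The values of the interpretation are sets in the sense of ZF. A type of this class is a universe of
  such sets, \<open>elts a\<close> being the HOL set of the members of \<open>a\<close>; choice is inherited from HOL.
  The sets \<open>univ 0\<close>, \<open>univ 1\<close>, \dots are an increasing sequence of Grothendieck universes.
\<close>

class zf_universes =
  fixes elts :: "'a \<Rightarrow> 'a set"
    and univ :: "nat \<Rightarrow> 'a"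
  assumes extensionality: "elts a = elts b \<Longrightarrow> a = b"
    and foundation: "wf {(a, b). a \<in> elts b}"
    and pairing: "\<exists>c. elts c = {a, b}"
    and union: "\<exists>c. elts c = \<Union> (elts ` elts a)"
    and powerset: "\<exists>c. elts c = {b. elts b \<subseteq> elts a}"
    and separation: "\<exists>c. elts c = {b \<in> elts a. P b}"
    and replacement: "\<exists>c. elts c = F ` elts a"
    and infinity: "\<exists>c. (\<exists>a\<in>elts c. elts a = {}) \<and>
                       (\<forall>a\<in>elts c. \<exists>b\<in>elts c. elts b = insert a (elts a))"
    and univ_transitive: "a \<in> elts (univ i) \<Longrightarrow> elts a \<subseteq> elts (univ i)"
    and univ_pairing: "\<lbrakk>a \<in> elts (univ i); b \<in> elts (univ i); elts c = {a, b}\<rbrakk> \<Longrightarrow> c \<in> elts (univ i)"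
    and univ_powerset: "\<lbrakk>a \<in> elts (univ i); elts c = {b. elts b \<subseteq> elts a}\<rbrakk> \<Longrightarrow> c \<in> elts (univ i)"
    and univ_union: "\<lbrakk>a \<in> elts (univ i); F ` elts a \<subseteq> elts (univ i); elts c = \<Union> (elts ` F ` elts a)\<rbrakk>
                       \<Longrightarrow> c \<in> elts (univ i)"
    and univ_infinity: "\<exists>c\<in>elts (univ i). (\<exists>a\<in>elts c. elts a = {}) \<and>
                       (\<forall>a\<in>elts c. \<exists>b\<in>elts c. elts b = insert a (elts a))"
    and univ_increasing: "univ i \<in> elts (univ (Suc i))"

text \<open>Only meaningful for those \<open>S\<close> that are small, that is, of the form \<open>elts a\<close>.\<close>

definition vset :: "'v::zf_universes set \<Rightarrow> 'v" where
  "vset S = inv elts S"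

definition vpair :: "'v::zf_universes \<Rightarrow> 'v \<Rightarrow> 'v" where
  "vpair a b = vset {vset {a}, vset {a, b}}"

definition vgraph :: "'v::zf_universes set \<Rightarrow> ('v \<Rightarrow> 'v) \<Rightarrow> 'v" where
  "vgraph D f = vset ((\<lambda>a. vpair a (f a)) ` D)"

definition vapp :: "'v::zf_universes \<Rightarrow> 'v \<Rightarrow> 'v option" where
  "vapp f a = (if \<exists>!b. vpair a b \<in> elts f then Some (THE b. vpair a b \<in> elts f) else None)"

definition vProd :: "'v::zf_universes set \<Rightarrow> ('v \<Rightarrow> 'v) \<Rightarrow> 'v" where
  "vProd D B = vset {vgraph D f | f. \<forall>a\<in>D. f a \<in> elts (B a)}"


section \<open>The extended calculus of constructions\<close>

text \<open>
  Terms are in de Bruijn notation. \<open>Prod A B\<close>, \<open>Lam A M\<close> and \<open>Sig A B\<close> bind one variable in their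
  second argument; \<open>MkPair S M N\<close> is the pair of \<open>M\<close> and \<open>N\<close> annotated with its type \<open>S\<close>.
\<close>

datatype tm =
    Var nat
  | Prop
  | Type nat
  | Prod tm tm
  | Lam tm tm
  | App tm tm
  | Sig tm tm
  | MkPair tm tm tm
  | Proj1 tm
  | Proj2 tm

primrec lift :: "nat \<Rightarrow> tm \<Rightarrow> tm" where
  "lift k (Var i) = Var (if i < k then i else Suc i)"
| "lift k Prop = Prop"
| "lift k (Type j) = Type j"
| "lift k (Prod A B) = Prod (lift k A) (lift (Suc k) B)"
| "lift k (Lam A M) = Lam (lift k A) (lift (Suc k) M)"
| "lift k (App M N) = App (lift k M) (lift k N)"
| "lift k (Sig A B) = Sig (lift k A) (lift (Suc k) B)"
| "lift k (MkPair S M N) = MkPair (lift k S) (lift k M) (lift k N)"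
| "lift k (Proj1 M) = Proj1 (lift k M)"
| "lift k (Proj2 M) = Proj2 (lift k M)"

text \<open>\<open>subst k N M\<close> replaces variable \<open>k\<close> of \<open>M\<close> by \<open>N\<close> and lowers the variables above \<open>k\<close>.\<close>

primrec subst :: "nat \<Rightarrow> tm \<Rightarrow> tm \<Rightarrow> tm" where
  "subst k N (Var i) = (if i < k then Var i else if i = k then N else Var (i - 1))"
| "subst k N Prop = Prop"
| "subst k N (Type j) = Type j"
| "subst k N (Prod A B) = Prod (subst k N A) (subst (Suc k) (lift 0 N) B)"
| "subst k N (Lam A M) = Lam (subst k N A) (subst (Suc k) (lift 0 N) M)"
| "subst k N (App M M') = App (subst k N M) (subst k N M')"
| "subst k N (Sig A B) = Sig (subst k N A) (subst (Suc k) (lift 0 N) B)"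
| "subst k N (MkPair S M M') = MkPair (subst k N S) (subst k N M) (subst k N M')"
| "subst k N (Proj1 M) = Proj1 (subst k N M)"
| "subst k N (Proj2 M) = Proj2 (subst k N M)"

primrec occurs :: "nat \<Rightarrow> tm \<Rightarrow> bool" where
  "occurs k (Var i) \<longleftrightarrow> i = k"
| "occurs k Prop \<longleftrightarrow> False"
| "occurs k (Type j) \<longleftrightarrow> False"
| "occurs k (Prod A B) \<longleftrightarrow> occurs k A \<or> occurs (Suc k) B"
| "occurs k (Lam A M) \<longleftrightarrow> occurs k A \<or> occurs (Suc k) M"
| "occurs k (App M N) \<longleftrightarrow> occurs k M \<or> occurs k N"
| "occurs k (Sig A B) \<longleftrightarrow> occurs k A \<or> occurs (Suc k) B"
| "occurs k (MkPair S M N) \<longleftrightarrow> occurs k S \<or> occurs k M \<or> occurs k N"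
| "occurs k (Proj1 M) \<longleftrightarrow> occurs k M"
| "occurs k (Proj2 M) \<longleftrightarrow> occurs k M"

text \<open>
  For terms without variable 0: the same term read in the context without that variable.
  The term substituted for it is irrelevant.
\<close>

definition unlift :: "tm \<Rightarrow> tm" where
  "unlift M = subst 0 Prop M"

inductive red :: "tm \<Rightarrow> tm \<Rightarrow> bool" where
  beta: "red (App (Lam A M) N) (subst 0 N M)"
| proj1: "red (Proj1 (MkPair S M N)) M"
| proj2: "red (Proj2 (MkPair S M N)) N"
| "red A A' \<Longrightarrow> red (Prod A B) (Prod A' B)"
| "red B B' \<Longrightarrow> red (Prod A B) (Prod A B')"
| "red A A' \<Longrightarrow> red (Lam A M) (Lam A' M)"
| "red M M' \<Longrightarrow> red (Lam A M) (Lam A M')"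
| "red M M' \<Longrightarrow> red (App M N) (App M' N)"
| "red N N' \<Longrightarrow> red (App M N) (App M N')"
| "red A A' \<Longrightarrow> red (Sig A B) (Sig A' B)"
| "red B B' \<Longrightarrow> red (Sig A B) (Sig A B')"
| "red S S' \<Longrightarrow> red (MkPair S M N) (MkPair S' M N)"
| "red M M' \<Longrightarrow> red (MkPair S M N) (MkPair S M' N)"
| "red N N' \<Longrightarrow> red (MkPair S M N) (MkPair S M N')"
| "red M M' \<Longrightarrow> red (Proj1 M) (Proj1 M')"
| "red M M' \<Longrightarrow> red (Proj2 M) (Proj2 M')"

abbreviation conv :: "tm \<Rightarrow> tm \<Rightarrow> bool" (infix "\<simeq>" 50) where
  "A \<simeq> B \<equiv> equivclp red A B"

text \<open>Luo's cumulativity relation.\<close>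

inductive cumul :: "tm \<Rightarrow> tm \<Rightarrow> bool" (infix "\<preceq>" 50) where
  conv: "A \<simeq> B \<Longrightarrow> A \<preceq> B"
| trans: "A \<preceq> B \<Longrightarrow> B \<preceq> C \<Longrightarrow> A \<preceq> C"
| Prop_Type: "Prop \<preceq> Type j"
| Type_Type: "j \<le> k \<Longrightarrow> Type j \<preceq> Type k"
| Prod: "A \<simeq> A' \<Longrightarrow> B \<preceq> B' \<Longrightarrow> Prod A B \<preceq> Prod A' B'"
| Sig: "A \<preceq> A' \<Longrightarrow> B \<preceq> B' \<Longrightarrow> Sig A B \<preceq> Sig A' B'"

text \<open>
  A context lists the types of the variables, most recent first, so \<open>A # \<Gamma>\<close> is \<open>\<Gamma>; (x : A)\<close>.
  As in Luo's presentation, \<open>\<Gamma>\<close> is valid iff \<open>\<Gamma> \<turnstile> Prop \<Colon> Type 0\<close>.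
\<close>

inductive typing :: "tm list \<Rightarrow> tm \<Rightarrow> tm \<Rightarrow> bool" ("_ \<turnstile> _ \<Colon> _" [50, 50, 50] 50) where
  Ax: "[] \<turnstile> Prop \<Colon> Type 0"
| Ext: "\<Gamma> \<turnstile> A \<Colon> Type j \<Longrightarrow> A # \<Gamma> \<turnstile> Prop \<Colon> Type 0"
| Type: "\<Gamma> \<turnstile> Prop \<Colon> Type 0 \<Longrightarrow> \<Gamma> \<turnstile> Type j \<Colon> Type (Suc j)"
| Var: "\<lbrakk>\<Gamma> \<turnstile> Prop \<Colon> Type 0; i < length \<Gamma>\<rbrakk> \<Longrightarrow> \<Gamma> \<turnstile> Var i \<Colon> (lift 0 ^^ Suc i) (\<Gamma> ! i)"
| Prod_Prop: "A # \<Gamma> \<turnstile> P \<Colon> Prop \<Longrightarrow> \<Gamma> \<turnstile> Prod A P \<Colon> Prop"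
| Prod_Type: "\<lbrakk>\<Gamma> \<turnstile> A \<Colon> Type j; A # \<Gamma> \<turnstile> B \<Colon> Type j\<rbrakk> \<Longrightarrow> \<Gamma> \<turnstile> Prod A B \<Colon> Type j"
| Lam: "A # \<Gamma> \<turnstile> M \<Colon> B \<Longrightarrow> \<Gamma> \<turnstile> Lam A M \<Colon> Prod A B"
| App: "\<lbrakk>\<Gamma> \<turnstile> M \<Colon> Prod A B; \<Gamma> \<turnstile> N \<Colon> A\<rbrakk> \<Longrightarrow> \<Gamma> \<turnstile> App M N \<Colon> subst 0 N B"
| Sig: "\<lbrakk>\<Gamma> \<turnstile> A \<Colon> Type j; A # \<Gamma> \<turnstile> B \<Colon> Type j\<rbrakk> \<Longrightarrow> \<Gamma> \<turnstile> Sig A B \<Colon> Type j"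
| Pair: "\<lbrakk>\<Gamma> \<turnstile> M \<Colon> A; \<Gamma> \<turnstile> N \<Colon> subst 0 M B; A # \<Gamma> \<turnstile> B \<Colon> Type j\<rbrakk>
          \<Longrightarrow> \<Gamma> \<turnstile> MkPair (Sig A B) M N \<Colon> Sig A B"
| Proj1: "\<Gamma> \<turnstile> M \<Colon> Sig A B \<Longrightarrow> \<Gamma> \<turnstile> Proj1 M \<Colon> A"
| Proj2: "\<Gamma> \<turnstile> M \<Colon> Sig A B \<Longrightarrow> \<Gamma> \<turnstile> Proj2 M \<Colon> subst 0 (Proj1 M) B"
| Cumul: "\<lbrakk>\<Gamma> \<turnstile> M \<Colon> A; \<Gamma> \<turnstile> A' \<Colon> Type j; A \<preceq> A'\<rbrakk> \<Longrightarrow> \<Gamma> \<turnstile> M \<Colon> A'"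

definition valid_ctx :: "tm list \<Rightarrow> bool" where
  "valid_ctx \<Gamma> \<longleftrightarrow> \<Gamma> \<turnstile> Prop \<Colon> Type 0"

definition is_prop :: "tm list \<Rightarrow> tm \<Rightarrow> bool" where
  "is_prop \<Gamma> A \<longleftrightarrow> \<Gamma> \<turnstile> A \<Colon> Prop"

definition is_type :: "tm list \<Rightarrow> tm \<Rightarrow> bool" where
  "is_type \<Gamma> A \<longleftrightarrow> (\<exists>j. \<Gamma> \<turnstile> A \<Colon> Type j)"

definition is_proof :: "tm list \<Rightarrow> tm \<Rightarrow> bool" where
  "is_proof \<Gamma> M \<longleftrightarrow> (\<exists>P. is_prop \<Gamma> P \<and> \<Gamma> \<turnstile> M \<Colon> P)"


subsection \<open>Logical symbols\<close>

definition Imp :: "tm \<Rightarrow> tm \<Rightarrow> tm" where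
  "Imp A B = Prod A (lift 0 B)"

definition Bot :: tm where
  "Bot = Prod Prop (Var 0)"

definition Conj :: "tm \<Rightarrow> tm \<Rightarrow> tm" where
  "Conj A B = Prod Prop (Imp (Imp (lift 0 A) (Imp (lift 0 B) (Var 0))) (Var 0))"

definition Disj :: "tm \<Rightarrow> tm \<Rightarrow> tm" where
  "Disj A B = Prod Prop (Imp (Imp (lift 0 A) (Var 0)) (Imp (Imp (lift 0 B) (Var 0)) (Var 0)))"

text \<open>
  \<open>Q\<close> lives in the context extended with \<open>x : A\<close>; in the encoding the bound proposition \<open>P\<close> sits
  below \<open>x\<close>, hence \<open>lift 1 Q\<close> and \<open>Var 1\<close>.
\<close>

definition Exi :: "tm \<Rightarrow> tm \<Rightarrow> tm" where
  "Exi A Q = Prod Prop (Imp (Prod (lift 0 A) (Imp (lift 1 Q) (Var 1))) (Var 0))"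

definition Iff :: "tm \<Rightarrow> tm \<Rightarrow> tm" where
  "Iff A B = Conj (Imp A B) (Imp B A)"

definition Eq :: "tm \<Rightarrow> tm \<Rightarrow> tm \<Rightarrow> tm" where
  "Eq A M N = Prod (Imp A Prop) (Iff (App (Var 0) (lift 0 M)) (App (Var 0) (lift 0 N)))"


section \<open>The topological interpretation\<close>

definition reference_point :: "'v::zf_universes topology \<Rightarrow> 'v \<Rightarrow> bool" where
  "reference_point X p \<longleftrightarrow> p \<in> topspace X \<and> openin X (\<Inter> {U. openin X U \<and> p \<in> U})"

definition meet :: "'a topology \<Rightarrow> 'a set set \<Rightarrow> 'a set" where
  "meet X S = (if S = {} then topspace X else X interior_of (\<Inter> S))"

definition expo :: "'a topology \<Rightarrow> 'a set \<Rightarrow> 'a set \<Rightarrow> 'a set" where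
  "expo X b a = \<Union> {t. openin X t \<and> t \<inter> a \<subseteq> b}"

text \<open>
  The interpretation is a partial function: it is undefined where its clauses make no sense, that is,
  if a function is applied outside of its domain, a Heyting operation is applied to something that is
  not an element of \<open>\<O>(X)\<close>, or a dependent product of propositions really depends on its proof variable.
\<close>

definition as_open :: "'v::zf_universes topology \<Rightarrow> 'v \<Rightarrow> 'v set option" where
  "as_open X a = (if openin X (elts a) then Some (elts a) else None)"

definition family :: "'a set \<Rightarrow> ('a \<Rightarrow> 'b option) \<Rightarrow> ('a \<Rightarrow> 'b) option" where
  "family D f = (if \<forall>a\<in>D. f a \<noteq> None then Some (\<lambda>a. the (f a)) else None)"

text \<open>The values of a variable of type \<open>A\<close> over which the set-theoretic constructions range.\<close>

definition dom_of :: "'v::zf_universes \<Rightarrow> tm list \<Rightarrow> tm \<Rightarrow> 'v \<Rightarrow> 'v set" where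
  "dom_of p \<Gamma> A a = (if is_prop \<Gamma> A then elts a \<inter> {p} else elts a)"

lemma size_subst_Prop [simp]: "size (subst k Prop M) = size M"
  by (induction M arbitrary: k) auto

text \<open>
  \<open>interp X p \<Gamma> M \<gamma>\<close> is the value of \<open>\<Gamma> \<turnstile> M\<close> at \<open>\<gamma>\<close>, where \<open>\<gamma>\<close> lists the values of the variables in
  the order of \<open>\<Gamma>\<close>.
\<close>

function interp ::
  "'v::zf_universes topology \<Rightarrow> 'v \<Rightarrow> tm list \<Rightarrow> tm \<Rightarrow> 'v list \<Rightarrow> 'v option" where
  "interp X p \<Gamma> M \<gamma> = (if is_proof \<Gamma> M then Some p else (case M of
      Var i \<Rightarrow> if i < length \<gamma> then Some (\<gamma> ! i) else None
    | Prop \<Rightarrow> Some (vset (vset ` {U. openin X U}))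
    | Type j \<Rightarrow> Some (univ j)
    | Prod P Q \<Rightarrow>
        if is_prop (P # \<Gamma>) Q then
          if is_prop \<Gamma> P then
            if occurs 0 Q then None
            else do {
              a \<leftarrow> interp X p \<Gamma> P \<gamma> \<bind> as_open X;
              b \<leftarrow> interp X p \<Gamma> (unlift Q) \<gamma> \<bind> as_open X;
              Some (vset (expo X b a))
            }
          else do {
            a \<leftarrow> interp X p \<Gamma> P \<gamma>;
            q \<leftarrow> family (elts a) (\<lambda>\<alpha>. interp X p (P # \<Gamma>) Q (\<alpha> # \<gamma>) \<bind> as_open X);
            Some (vset (meet X (q ` elts a)))
          }
        else do {
          a \<leftarrow> interp X p \<Gamma> P \<gamma>;
          q \<leftarrow> family (dom_of p \<Gamma> P a) (\<lambda>\<alpha>. interp X p (P # \<Gamma>) Q (\<alpha> # \<gamma>));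
          Some (vProd (dom_of p \<Gamma> P a) q)
        }
    | Lam A N \<Rightarrow> do {
        a \<leftarrow> interp X p \<Gamma> A \<gamma>;
        f \<leftarrow> family (dom_of p \<Gamma> A a) (\<lambda>\<alpha>. interp X p (A # \<Gamma>) N (\<alpha> # \<gamma>));
        Some (vgraph (dom_of p \<Gamma> A a) f)
      }
    | App N N' \<Rightarrow> do {
        f \<leftarrow> interp X p \<Gamma> N \<gamma>;
        a \<leftarrow> interp X p \<Gamma> N' \<gamma>;
        vapp f a
      }
    | Sig A B \<Rightarrow> do {
        a \<leftarrow> interp X p \<Gamma> A \<gamma>;
        b \<leftarrow> family (dom_of p \<Gamma> A a) (\<lambda>\<alpha>. interp X p (A # \<Gamma>) B (\<alpha> # \<gamma>));
        Some (vset {vpair \<alpha> \<beta> | \<alpha> \<beta>. \<alpha> \<in> dom_of p \<Gamma> A a \<and> \<beta> \<in> dom_of p (A # \<Gamma>) B (b \<alpha>)})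
      }
    | MkPair _ N N' \<Rightarrow> do {
        a \<leftarrow> interp X p \<Gamma> N \<gamma>;
        b \<leftarrow> interp X p \<Gamma> N' \<gamma>;
        Some (vpair a b)
      }
    | Proj1 N \<Rightarrow> do {
        c \<leftarrow> interp X p \<Gamma> N \<gamma>;
        if \<exists>a b. c = vpair a b then Some (THE a. \<exists>b. c = vpair a b) else None
      }
    | Proj2 N \<Rightarrow> do {
        c \<leftarrow> interp X p \<Gamma> N \<gamma>;
        if \<exists>a b. c = vpair a b then Some (THE b. \<exists>a. c = vpair a b) else None
      }))"
  by pat_completeness auto
termination
  by (relation "measure (\<lambda>(X, p, \<Gamma>, M, \<gamma>). size M)") (auto simp: unlift_def)

declare interp.simps [simp del]

text \<open>The value of a proposition, as an open set.\<close>

definition interp_open ::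
  "'v::zf_universes topology \<Rightarrow> 'v \<Rightarrow> tm list \<Rightarrow> tm \<Rightarrow> 'v list \<Rightarrow> 'v set option" where
  "interp_open X p \<Gamma> A \<gamma> = interp X p \<Gamma> A \<gamma> \<bind> as_open X"

primrec interp_ctx :: "'v::zf_universes topology \<Rightarrow> 'v \<Rightarrow> tm list \<Rightarrow> 'v list set" where
  "interp_ctx X p [] = {[]}"
| "interp_ctx X p (A # \<Gamma>) =
     {\<alpha> # \<gamma> | \<alpha> \<gamma> a. \<gamma> \<in> interp_ctx X p \<Gamma> \<and> interp X p \<Gamma> A \<gamma> = Some a \<and> \<alpha> \<in> elts a}"

end

theory Submission
  imports Defs "HOL-Library.Confluence"
begin

text \<open>
  Each clause is a computation in the Heyting algebra \<open>\<O>(X)\<close>: the intersection over all open \<open>U\<close>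
  coming from the impredicative encoding is bounded below by the expected open set, and is attained
  at the instance where \<open>U\<close> is that set. For Leibniz equality one uses a characteristic function that
  takes the value \<open>{}\<close> at one point and \<open>X\<close> at all others; these are different open sets since \<open>p \<in> X\<close>.

  The case distinctions of the interpretation depend on typability, so two syntactic facts are needed.
  First, the encoded formulas are not proofs: by subject reduction (hence by confluence and generation)
  a proposition never converts to a universe. Secondly, inserting a variable of an inhabited type
  into the context does not change which terms are propositions or proofs, by weakening in one
  direction and by substituting an inhabitant in the other; the bound variables of the encodings
  have the types \<open>Prop\<close> and \<open>A \<rightarrow> Prop\<close>, which are inhabited.
\<close>


section \<open>Lifting and substitution\<close>

lemma lift_lift: "i \<le> k \<Longrightarrow> lift i (lift k M) = lift (Suc k) (lift i M)"
  by (induction M arbitrary: i k) auto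

lemma subst_lift [simp]: "subst k N (lift k M) = M"
  by (induction M arbitrary: k N) auto

lemma lift_subst_ge: "k \<le> i \<Longrightarrow> lift i (subst k N M) = subst k (lift i N) (lift (Suc i) M)"
  by (induction M arbitrary: k i N) (auto simp: lift_lift)

lemma lift_subst_le: "i \<le> k \<Longrightarrow> lift i (subst k N M) = subst (Suc k) (lift i N) (lift i M)"
  by (induction M arbitrary: k i N) (auto simp: lift_lift)

text \<open>Its instance \<open>i = 0\<close> lets a substitution pass through a contracted beta
  redex and through the dependent types of applications, pairs and second projections.\<close>

lemma subst_subst:
  "i \<le> k \<Longrightarrow> subst k N (subst i P M) = subst i (subst k N P) (subst (Suc k) (lift i N) M)"
  by (induction M arbitrary: k i N P) (auto simp: lift_lift lift_subst_le[symmetric])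

lemma subst_lift_Suc: "i \<le> k \<Longrightarrow> subst (Suc k) (lift i N) (lift i M) = lift i (subst k N M)"
  by (simp add: lift_subst_le)

lemma occurs_lift [simp]: "k < i \<Longrightarrow> occurs k (lift i M) = occurs k M"
  by (induction M arbitrary: k i) auto

lemma not_occurs_lift [simp]: "\<not> occurs k (lift k M)"
  by (induction M arbitrary: k) auto

lemma unlift_lift [simp]: "unlift (lift 0 M) = M"
  by (simp add: unlift_def)

text \<open>Needed because the clause of \<open>interp\<close> for implications recurses on
  \<open>unlift Q\<close> instead of \<open>Q\<close>.\<close>

lemma unlift_lift_Suc: "unlift (lift (Suc n) M) = lift n (unlift M)"
  by (simp add: unlift_def lift_subst_ge)


section \<open>Confluence\<close>

text \<open>Parallel reduction of Tait and Martin-Loef: one step contracts any selection of the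
  redexes already present. Unlike \<open>red\<close>, it has a diamond property in single
  steps.\<close>

inductive par :: "tm \<Rightarrow> tm \<Rightarrow> bool" where
  par_Var: "par (Var i) (Var i)"
| par_Prop: "par Prop Prop"
| par_Type: "par (Type j) (Type j)"
| par_Prod: "par A A' \<Longrightarrow> par B B' \<Longrightarrow> par (Prod A B) (Prod A' B')"
| par_Lam: "par A A' \<Longrightarrow> par M M' \<Longrightarrow> par (Lam A M) (Lam A' M')"
| par_App: "par M M' \<Longrightarrow> par N N' \<Longrightarrow> par (App M N) (App M' N')"
| par_Sig: "par A A' \<Longrightarrow> par B B' \<Longrightarrow> par (Sig A B) (Sig A' B')"
| par_MkPair: "par S S' \<Longrightarrow> par M M' \<Longrightarrow> par N N' \<Longrightarrow> par (MkPair S M N) (MkPair S' M' N')"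
| par_Proj1: "par M M' \<Longrightarrow> par (Proj1 M) (Proj1 M')"
| par_Proj2: "par M M' \<Longrightarrow> par (Proj2 M) (Proj2 M')"
| par_beta: "par M M' \<Longrightarrow> par N N' \<Longrightarrow> par (App (Lam A M) N) (subst 0 N' M')"
| par_proj1: "par M M' \<Longrightarrow> par (Proj1 (MkPair S M N)) M'"
| par_proj2: "par N N' \<Longrightarrow> par (Proj2 (MkPair S M N)) N'"

inductive_cases par_VarE: "par (Var i) K"
inductive_cases par_PropE: "par Prop K"
inductive_cases par_TypeE: "par (Type j) K"
inductive_cases par_ProdE: "par (Prod A B) K"
inductive_cases par_LamE: "par (Lam A M) K"
inductive_cases par_AppE: "par (App M N) K"
inductive_cases par_SigE: "par (Sig A B) K"
inductive_cases par_MkPairE: "par (MkPair S M N) K"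
inductive_cases par_Proj1E: "par (Proj1 M) K"
inductive_cases par_Proj2E: "par (Proj2 M) K"

lemma par_refl [simp]: "par M M"
  by (induction M) (auto intro: par.intros)

lemma par_lift: "par M M' \<Longrightarrow> par (lift k M) (lift k M')"
  by (induction arbitrary: k rule: par.induct) (auto simp: lift_subst_ge intro: par.intros)

text \<open>Both the term and what is substituted may move in the same step, since contracting a
  redex can copy its argument; this closes the beta case of \<open>par_dev\<close>.\<close>

lemma par_subst: "par M M' \<Longrightarrow> par N N' \<Longrightarrow> par (subst k N M) (subst k N' M')"
  by (induction arbitrary: k N N' rule: par.induct)
    (auto simp: subst_subst par_lift intro: par.intros)

lemma red_imp_par: "red M M' \<Longrightarrow> par M M'"
  by (induction rule: red.induct) (auto intro: par.intros)

lemma reds_Prod: "red\<^sup>*\<^sup>* A A' \<Longrightarrow> red\<^sup>*\<^sup>* B B' \<Longrightarrow> red\<^sup>*\<^sup>* (Prod A B) (Prod A' B')"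
  apply (rule rtranclp_trans[of _ _ "Prod A' B"])
   apply (erule rtranclp_induct[of red A]; blast intro: red.intros rtranclp.rtrancl_into_rtrancl)
  apply (erule rtranclp_induct[of red B]; blast intro: red.intros rtranclp.rtrancl_into_rtrancl)
  done

lemma reds_Lam: "red\<^sup>*\<^sup>* A A' \<Longrightarrow> red\<^sup>*\<^sup>* M M' \<Longrightarrow> red\<^sup>*\<^sup>* (Lam A M) (Lam A' M')"
  apply (rule rtranclp_trans[of _ _ "Lam A' M"])
   apply (erule rtranclp_induct[of red A]; blast intro: red.intros rtranclp.rtrancl_into_rtrancl)
  apply (erule rtranclp_induct[of red M]; blast intro: red.intros rtranclp.rtrancl_into_rtrancl)
  done

lemma reds_App: "red\<^sup>*\<^sup>* M M' \<Longrightarrow> red\<^sup>*\<^sup>* N N' \<Longrightarrow> red\<^sup>*\<^sup>* (App M N) (App M' N')"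
  apply (rule rtranclp_trans[of _ _ "App M' N"])
   apply (erule rtranclp_induct[of red M]; blast intro: red.intros rtranclp.rtrancl_into_rtrancl)
  apply (erule rtranclp_induct[of red N]; blast intro: red.intros rtranclp.rtrancl_into_rtrancl)
  done

lemma reds_Sig: "red\<^sup>*\<^sup>* A A' \<Longrightarrow> red\<^sup>*\<^sup>* B B' \<Longrightarrow> red\<^sup>*\<^sup>* (Sig A B) (Sig A' B')"
  apply (rule rtranclp_trans[of _ _ "Sig A' B"])
   apply (erule rtranclp_induct[of red A]; blast intro: red.intros rtranclp.rtrancl_into_rtrancl)
  apply (erule rtranclp_induct[of red B]; blast intro: red.intros rtranclp.rtrancl_into_rtrancl)
  done

lemma reds_MkPair:
  "red\<^sup>*\<^sup>* S S' \<Longrightarrow> red\<^sup>*\<^sup>* M M' \<Longrightarrow> red\<^sup>*\<^sup>* N N' \<Longrightarrow> red\<^sup>*\<^sup>* (MkPair S M N) (MkPair S' M' N')"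
  apply (rule rtranclp_trans[of _ _ "MkPair S' M N"])
   apply (erule rtranclp_induct[of red S]; blast intro: red.intros rtranclp.rtrancl_into_rtrancl)
  apply (rule rtranclp_trans[of _ _ "MkPair S' M' N"])
   apply (erule rtranclp_induct[of red M]; blast intro: red.intros rtranclp.rtrancl_into_rtrancl)
  apply (erule rtranclp_induct[of red N]; blast intro: red.intros rtranclp.rtrancl_into_rtrancl)
  done

lemma reds_Proj1: "red\<^sup>*\<^sup>* M M' \<Longrightarrow> red\<^sup>*\<^sup>* (Proj1 M) (Proj1 M')"
  by (erule rtranclp_induct; blast intro: red.intros rtranclp.rtrancl_into_rtrancl)

lemma reds_Proj2: "red\<^sup>*\<^sup>* M M' \<Longrightarrow> red\<^sup>*\<^sup>* (Proj2 M) (Proj2 M')"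
  by (erule rtranclp_induct; blast intro: red.intros rtranclp.rtrancl_into_rtrancl)

lemma par_imp_reds: "par M M' \<Longrightarrow> red\<^sup>*\<^sup>* M M'"
proof (induction rule: par.induct)
  case (par_beta M M' N N' A)
  then have "red\<^sup>*\<^sup>* (App (Lam A M) N) (App (Lam A M') N')"
    by (intro reds_App reds_Lam) auto
  then show ?case by (blast intro: red.beta rtranclp.rtrancl_into_rtrancl)
next
  case (par_proj1 M M' S N)
  then have "red\<^sup>*\<^sup>* (Proj1 (MkPair S M N)) (Proj1 (MkPair S M' N))"
    by (intro reds_Proj1 reds_MkPair) auto
  then show ?case by (blast intro: red.proj1 rtranclp.rtrancl_into_rtrancl)
next
  case (par_proj2 N N' S M)
  then have "red\<^sup>*\<^sup>* (Proj2 (MkPair S M N)) (Proj2 (MkPair S M N'))"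
    by (intro reds_Proj2 reds_MkPair) auto
  then show ?case by (blast intro: red.proj2 rtranclp.rtrancl_into_rtrancl)
qed (auto intro: reds_Prod reds_Lam reds_App reds_Sig reds_MkPair reds_Proj1 reds_Proj2)

text \<open>Parallel reduction lies between \<open>red\<close> and its reflexive transitive closure,
  so confluence can be transferred from \<open>par\<close> to \<open>red\<close>.\<close>

lemma rtranclp_par: "par\<^sup>*\<^sup>* = red\<^sup>*\<^sup>*"
proof (rule antisym)
  show "par\<^sup>*\<^sup>* \<le> red\<^sup>*\<^sup>*"
    using rtranclp_mono[of par "red\<^sup>*\<^sup>*"] par_imp_reds by auto
  show "red\<^sup>*\<^sup>* \<le> par\<^sup>*\<^sup>*"
    by (rule rtranclp_mono) (use red_imp_par in auto)
qed

text \<open>Takahashi's complete development.\<close>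

fun dev :: "tm \<Rightarrow> tm" where
  "dev (App (Lam A M) N) = subst 0 (dev N) (dev M)"
| "dev (Proj1 (MkPair S M N)) = dev M"
| "dev (Proj2 (MkPair S M N)) = dev N"
| "dev (Var i) = Var i"
| "dev Prop = Prop"
| "dev (Type j) = Type j"
| "dev (Prod A B) = Prod (dev A) (dev B)"
| "dev (Lam A M) = Lam (dev A) (dev M)"
| "dev (App M N) = App (dev M) (dev N)"
| "dev (Sig A B) = Sig (dev A) (dev B)"
| "dev (MkPair S M N) = MkPair (dev S) (dev M) (dev N)"
| "dev (Proj1 M) = Proj1 (dev M)"
| "dev (Proj2 M) = Proj2 (dev M)"

text \<open>The triangle property: \<open>dev M\<close> contracts every redex of \<open>M\<close>,
  so any parallel reduct can contract those it left out and arrive there. The target does not depend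
  on \<open>M'\<close>, hence two reducts of \<open>M\<close> meet in \<open>dev M\<close>.\<close>

lemma par_dev: "par M M' \<Longrightarrow> par M' (dev M)"
proof (induction M arbitrary: M' rule: dev.induct)
  case (1 A M N)
  from 1(3) show ?case
    by (elim par_AppE par_LamE) (auto intro: par_beta par_subst 1)
next
  case (2 S M N)
  from 2(2) show ?case
    by (elim par_Proj1E par_MkPairE) (auto intro: par_proj1 2)
next
  case (3 S M N)
  from 3(2) show ?case
    by (elim par_Proj2E par_MkPairE) (auto intro: par_proj2 3)
qed (auto elim!: par_VarE par_PropE par_TypeE par_ProdE par_LamE par_AppE par_SigE par_MkPairE
      par_Proj1E par_Proj2E intro: par.intros)

lemma confluentp_red: "confluentp red"
proof -
  have "strong_confluentp par"
    by (rule strong_confluentpI) (blast intro: par_dev)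
  then have "confluentp par" by (rule strong_confluentp_imp_confluentp)
  then show ?thesis by (simp add: confluentp_def rtranclp_par rtranclp_conversep)
qed

text \<open>The Church-Rosser form of confluence. The inversion facts about conversion below are
  read off a common reduct.\<close>

lemma conv_iff_joinable: "A \<simeq> B \<longleftrightarrow> (\<exists>C. red\<^sup>*\<^sup>* A C \<and> red\<^sup>*\<^sup>* B C)"
  using semiconfluentp_equivclp[OF confluentp_imp_semiconfluentp[OF confluentp_red]]
  by (auto simp: rtranclp_conversep)

section \<open>Inversion of reduction and conversion at universes, products and sums\<close>

inductive_cases red_VarE: "red (Var i) K"
inductive_cases red_PropE: "red Prop K"
inductive_cases red_TypeE: "red (Type j) K"
inductive_cases red_ProdE: "red (Prod A B) K"
inductive_cases red_LamE: "red (Lam A M) K"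
inductive_cases red_AppE: "red (App M N) K"
inductive_cases red_SigE: "red (Sig A B) K"
inductive_cases red_MkPairE: "red (MkPair S M N) K"
inductive_cases red_Proj1E: "red (Proj1 M) K"
inductive_cases red_Proj2E: "red (Proj2 M) K"

lemma reds_PropD: "red\<^sup>*\<^sup>* Prop K \<Longrightarrow> K = Prop"
  by (induction rule: rtranclp_induct) (auto elim: red_PropE)

lemma reds_TypeD: "red\<^sup>*\<^sup>* (Type j) K \<Longrightarrow> K = Type j"
  by (induction rule: rtranclp_induct) (auto elim: red_TypeE)

lemma reds_ProdD:
  "red\<^sup>*\<^sup>* (Prod A B) K \<Longrightarrow> \<exists>A' B'. K = Prod A' B' \<and> red\<^sup>*\<^sup>* A A' \<and> red\<^sup>*\<^sup>* B B'"
  by (induction rule: rtranclp_induct)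
    (auto elim!: red_ProdE intro: rtranclp.rtrancl_into_rtrancl)

lemma reds_SigD:
  "red\<^sup>*\<^sup>* (Sig A B) K \<Longrightarrow> \<exists>A' B'. K = Sig A' B' \<and> red\<^sup>*\<^sup>* A A' \<and> red\<^sup>*\<^sup>* B B'"
  by (induction rule: rtranclp_induct)
    (auto elim!: red_SigE intro: rtranclp.rtrancl_into_rtrancl)

lemma conv_Prop_iff: "A \<simeq> Prop \<longleftrightarrow> red\<^sup>*\<^sup>* A Prop"
  by (auto simp: conv_iff_joinable dest: reds_PropD)

lemma conv_Type_iff: "A \<simeq> Type j \<longleftrightarrow> red\<^sup>*\<^sup>* A (Type j)"
  by (auto simp: conv_iff_joinable dest: reds_TypeD)

lemma conv_ProdD: "Prod A B \<simeq> Prod A' B' \<Longrightarrow> A \<simeq> A' \<and> B \<simeq> B'"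
  by (fastforce simp: conv_iff_joinable dest!: reds_ProdD)

lemma conv_SigD: "Sig A B \<simeq> Sig A' B' \<Longrightarrow> A \<simeq> A' \<and> B \<simeq> B'"
  by (fastforce simp: conv_iff_joinable dest!: reds_SigD)

text \<open>Each of these four head symbols survives reduction, so a common reduct would need two
  different heads.\<close>

lemma conv_distinct:
  "\<not> Prop \<simeq> Type j" "\<not> Type j \<simeq> Prop"
  "\<not> Prop \<simeq> Prod A B" "\<not> Prod A B \<simeq> Prop" "\<not> Type j \<simeq> Prod A B" "\<not> Prod A B \<simeq> Type j"
  "\<not> Prop \<simeq> Sig A B" "\<not> Sig A B \<simeq> Prop" "\<not> Type j \<simeq> Sig A B" "\<not> Sig A B \<simeq> Type j"
  "\<not> Prod A B \<simeq> Sig A' B'" "\<not> Sig A' B' \<simeq> Prod A B"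
  by (auto simp: conv_iff_joinable dest!: reds_PropD reds_TypeD reds_ProdD reds_SigD)


section \<open>Conversion and cumulativity\<close>

lemma equivclp_map:
  assumes "equivclp r a b" and "\<And>x y. r x y \<Longrightarrow> equivclp s (f x) (f y)"
  shows "equivclp s (f a) (f b)"
  using assms(1)
proof (induction rule: equivclp_induct)
  case (step y z)
  then show ?case by (meson assms(2) equivclp_sym equivclp_trans)
qed simp

lemma red_lift: "red M M' \<Longrightarrow> red (lift k M) (lift k M')"
  by (induction arbitrary: k rule: red.induct) (auto simp: lift_subst_ge intro: red.intros)

lemma red_subst: "red M M' \<Longrightarrow> red (subst k N M) (subst k N M')"
  by (induction arbitrary: k N rule: red.induct) (auto simp: subst_subst intro: red.intros)

lemma conv_lift: "M \<simeq> M' \<Longrightarrow> lift k M \<simeq> lift k M'"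
  by (erule equivclp_map) (blast intro: red_lift)

lemma conv_subst: "M \<simeq> M' \<Longrightarrow> subst k N M \<simeq> subst k N M'"
  by (erule equivclp_map) (blast intro: red_subst)

text \<open>A step in \<open>N\<close> is repeated at every occurrence of variable \<open>k\<close>;
  a single parallel step performs all these copies at once.\<close>

lemma red_conv_subst: "red N N' \<Longrightarrow> subst k N M \<simeq> subst k N' M"
  by (intro rtranclp_into_equivclp par_imp_reds par_subst red_imp_par par_refl)

lemma cumul_lift: "A \<preceq> B \<Longrightarrow> lift k A \<preceq> lift k B"
  by (induction arbitrary: k rule: cumul.induct) (auto intro: cumul.intros conv_lift)

lemma cumul_subst: "A \<preceq> B \<Longrightarrow> subst k N A \<preceq> subst k N B"
proof (induction arbitrary: k N rule: cumul.induct)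
  case (trans A B C)
  then show ?case by (blast intro: cumul.trans)
qed (auto intro: cumul.intros conv_subst)

lemma cumul_refl [simp]: "A \<preceq> A"
  by (simp add: cumul.conv)

text \<open>Transitivity is a rule of \<open>cumul\<close>, so inversion needs an induction over a
  statement that composes: whatever lies above a term convertible to a product is convertible to a
  product again. Domains only convert, while codomains may grow.\<close>

lemma cumul_Prod_left:
  "X \<preceq> Y \<Longrightarrow> X \<simeq> Prod A B \<Longrightarrow> \<exists>A' B'. Y \<simeq> Prod A' B' \<and> A \<simeq> A' \<and> B \<preceq> B'"
proof (induction arbitrary: A B rule: cumul.induct)
  case (conv X Y)
  then show ?case by (meson cumul_refl equivclp_refl equivclp_sym equivclp_trans)
next
  case (trans X Y Z)
  then show ?case by (meson cumul.trans equivclp_trans)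
next
  case (Prod A0 A1 B0 B1)
  from conv_ProdD[OF Prod.prems] have "A0 \<simeq> A" "B0 \<simeq> B" by auto
  with Prod.hyps show ?case by (meson cumul.conv cumul.trans equivclp_refl equivclp_sym equivclp_trans)
qed (auto simp: conv_distinct)

lemma cumul_Sig_left:
  "X \<preceq> Y \<Longrightarrow> X \<simeq> Sig A B \<Longrightarrow> \<exists>A' B'. Y \<simeq> Sig A' B' \<and> A \<preceq> A' \<and> B \<preceq> B'"
proof (induction arbitrary: A B rule: cumul.induct)
  case (conv X Y)
  then show ?case by (meson cumul_refl equivclp_refl equivclp_sym equivclp_trans)
next
  case (trans X Y Z)
  then show ?case by (meson cumul.trans)
next
  case (Sig A0 A1 B0 B1)
  from conv_SigD[OF Sig.prems] have "A0 \<simeq> A" "B0 \<simeq> B" by auto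
  with Sig.hyps show ?case by (meson cumul.conv cumul.trans equivclp_refl equivclp_sym)
qed (auto simp: conv_distinct)

lemma cumul_ProdD: "Prod A B \<preceq> Prod A' B' \<Longrightarrow> A \<simeq> A' \<and> B \<preceq> B'"
  by (meson conv_ProdD cumul.conv cumul.trans cumul_Prod_left equivclp_refl equivclp_sym equivclp_trans)

lemma cumul_SigD: "Sig A B \<preceq> Sig A' B' \<Longrightarrow> A \<preceq> A' \<and> B \<preceq> B'"
  by (meson conv_SigD cumul.conv cumul.trans cumul_Sig_left equivclp_refl equivclp_sym)

text \<open>Taken up to conversion, since a type may be a universe in disguise. This is the
  invariant that separates the types of propositions and of predicate values from the propositions
  themselves.\<close>

definition conv_univ :: "tm \<Rightarrow> bool" where
  "conv_univ A \<longleftrightarrow> A \<simeq> Prop \<or> (\<exists>k. A \<simeq> Type k)"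

lemma conv_univ_simps [simp]:
  "conv_univ Prop" "conv_univ (Type k)" "\<not> conv_univ (Prod A B)"
  "\<not> conv_univ (Sig A B)"
  by (auto simp: conv_univ_def conv_distinct intro: equivclp_refl)

lemma conv_univ_cong: "A \<simeq> B \<Longrightarrow> conv_univ A \<longleftrightarrow> conv_univ B"
  unfolding conv_univ_def by (meson equivclp_sym equivclp_trans)

lemma conv_univ_subst: "conv_univ A \<Longrightarrow> conv_univ (subst k N A)"
  unfolding conv_univ_def by (metis conv_subst subst.simps(2,3))

text \<open>Cumulativity climbs from a universe only to universes: the remaining rules start at a
  product or a sum, which is convertible to none.\<close>

lemma cumul_conv_univ: "A \<preceq> B \<Longrightarrow> conv_univ A \<Longrightarrow> conv_univ B"
  by (induction rule: cumul.induct) (auto simp: conv_univ_cong) 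

lemma cumul_Prop_right: "A \<preceq> B \<Longrightarrow> B \<simeq> Prop \<Longrightarrow> A \<simeq> Prop"
  by (induction rule: cumul.induct) (auto simp: conv_distinct intro: equivclp_trans)

lemma not_Type_cumul_Prop [simp]: "\<not> Type j \<preceq> Prop"
  using cumul_Prop_right[of "Type j" Prop] by (auto simp: conv_distinct)


section \<open>Weakening and substitution\<close>

text \<open>The typing rules express validity of a context through the typing of
  \<open>Prop\<close>; this separate form can be peeled off one variable at a time.\<close>

inductive wf_ctx :: "tm list \<Rightarrow> bool" where
  wf_Nil: "wf_ctx []"
| wf_Cons: "wf_ctx \<Gamma> \<Longrightarrow> \<Gamma> \<turnstile> A \<Colon> Type j \<Longrightarrow> wf_ctx (A # \<Gamma>)"

inductive_cases wf_ctx_ConsE: "wf_ctx (A # \<Gamma>)"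

lemma typing_wf_ctx: "\<Gamma> \<turnstile> M \<Colon> A \<Longrightarrow> wf_ctx \<Gamma>"
  by (induction rule: typing.induct) (auto intro: wf_ctx.intros elim: wf_ctx_ConsE)

lemma wf_ctx_valid: "wf_ctx \<Gamma> \<Longrightarrow> \<Gamma> \<turnstile> Prop \<Colon> Type 0"
  by (induction rule: wf_ctx.induct) (auto intro: typing.Ax typing.Ext)

lemma ctx_valid: "\<Gamma> \<turnstile> M \<Colon> A \<Longrightarrow> \<Gamma> \<turnstile> Prop \<Colon> Type 0"
  by (intro wf_ctx_valid typing_wf_ctx)

lemma ctx_ConsD: "B # \<Gamma> \<turnstile> M \<Colon> A \<Longrightarrow> \<Gamma> \<turnstile> Prop \<Colon> Type 0 \<and> (\<exists>j. \<Gamma> \<turnstile> B \<Colon> Type j)"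
  by (drule typing_wf_ctx) (auto elim: wf_ctx_ConsE intro: wf_ctx_valid)

lemma Type_mono: "\<Gamma> \<turnstile> A \<Colon> Type j \<Longrightarrow> j \<le> k \<Longrightarrow> \<Gamma> \<turnstile> A \<Colon> Type k"
  by (rule typing.Cumul[OF _ typing.Type[OF ctx_valid] cumul.Type_Type])

lemma Prop_imp_Type: "\<Gamma> \<turnstile> A \<Colon> Prop \<Longrightarrow> \<Gamma> \<turnstile> A \<Colon> Type k"
  by (rule typing.Cumul[OF _ typing.Type[OF ctx_valid] cumul.Prop_Type])

lemma Prod_Type_max: "\<Gamma> \<turnstile> A \<Colon> Type i \<Longrightarrow> A # \<Gamma> \<turnstile> B \<Colon> Type j \<Longrightarrow> \<Gamma> \<turnstile> Prod A B \<Colon> Type (max i j)"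
  by (rule typing.Prod_Type; erule Type_mono; simp)

lemma Sig_Type_max: "\<Gamma> \<turnstile> A \<Colon> Type i \<Longrightarrow> A # \<Gamma> \<turnstile> B \<Colon> Type j \<Longrightarrow> \<Gamma> \<turnstile> Sig A B \<Colon> Type (max i j)"
  by (rule typing.Sig; erule Type_mono; simp)

text \<open>The iterated lifting of rule \<open>Var\<close>, recursively along the context so that
  inductions on contexts apply. The value for the empty context is a dummy.\<close>

fun lookup :: "tm list \<Rightarrow> nat \<Rightarrow> tm" where
  "lookup [] i = Prop"
| "lookup (A # \<Gamma>) 0 = lift 0 A"
| "lookup (A # \<Gamma>) (Suc i) = lift 0 (lookup \<Gamma> i)"

lemma lookup_eq: "i < length \<Gamma> \<Longrightarrow> lookup \<Gamma> i = (lift 0 ^^ Suc i) (\<Gamma> ! i)"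
  by (induction \<Gamma> i rule: lookup.induct) auto

lemma Var_lookup: "\<Gamma> \<turnstile> Prop \<Colon> Type 0 \<Longrightarrow> i < length \<Gamma> \<Longrightarrow> \<Gamma> \<turnstile> Var i \<Colon> lookup \<Gamma> i"
  using typing.Var by (simp only: lookup_eq)

text \<open>\<open>C\<close>, formed over \<open>\<Gamma>\<close>, is inserted below the
  \<open>n\<close> most recent variables of \<open>\<Delta>\<close>; the types of these are lifted
  accordingly.\<close>

inductive ctx_ins :: "tm \<Rightarrow> tm list \<Rightarrow> nat \<Rightarrow> tm list \<Rightarrow> tm list \<Rightarrow> bool" for C \<Gamma> where
  ins_0: "ctx_ins C \<Gamma> 0 \<Gamma> (C # \<Gamma>)"
| ins_Suc: "ctx_ins C \<Gamma> n \<Delta> \<Delta>' \<Longrightarrow> ctx_ins C \<Gamma> (Suc n) (A # \<Delta>) (lift n A # \<Delta>')"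

lemma ctx_ins_length: "ctx_ins C \<Gamma> n \<Delta> \<Delta>' \<Longrightarrow> length \<Delta>' = Suc (length \<Delta>) \<and> n \<le> length \<Delta>"
  by (induction rule: ctx_ins.induct) auto

lemma ctx_ins_lookup:
  "ctx_ins C \<Gamma> n \<Delta> \<Delta>' \<Longrightarrow> i < length \<Delta> \<Longrightarrow>
     lookup \<Delta>' (if i < n then i else Suc i) = lift n (lookup \<Delta> i)"
proof (induction arbitrary: i rule: ctx_ins.induct)
  case (ins_Suc n \<Delta> \<Delta>' A)
  show ?case
  proof (cases i)
    case (Suc i')
    with ins_Suc.IH[of i'] ins_Suc.prems show ?thesis
      by (cases "i' < n") (simp_all add: lift_lift[of 0 n])
  qed (simp add: lift_lift[of 0 n])
qed simp

text \<open>Insertion at an arbitrary depth is forced by the binder rules, which place the bound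
  variable on top of the inserted one.\<close>

theorem weakening:
  "\<Delta> \<turnstile> M \<Colon> A \<Longrightarrow> ctx_ins C \<Gamma> n \<Delta> \<Delta>' \<Longrightarrow> \<Gamma> \<turnstile> C \<Colon> Type k \<Longrightarrow> \<Delta>' \<turnstile> lift n M \<Colon> lift n A"
proof (induction arbitrary: n \<Delta>' rule: typing.induct)
  case Ax
  then show ?case by (auto elim!: ctx_ins.cases intro: typing.Ext)
next
  case (Ext \<Delta> A j)
  from Ext.prems(1) show ?case
  proof cases
    case ins_0
    with Ext.prems(2) show ?thesis by (auto intro: typing.Ext)
  next
    case (ins_Suc n' \<Delta>'')
    with Ext.IH[OF ins_Suc(3) Ext.prems(2)] show ?thesis by (auto intro: typing.Ext)
  qed
next
  case (Type \<Delta> j)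
  then show ?case by (auto intro: typing.Type)
next
  case (Var \<Delta> i)
  have v: "\<Delta>' \<turnstile> Prop \<Colon> Type 0" using Var.IH[OF Var.prems] by simp
  show ?case
    using Var_lookup[OF v, of "if i < n then i else Suc i"] ctx_ins_length[OF Var.prems(1)] Var.hyps(2)
    by (simp add: ctx_ins_lookup[OF Var.prems(1)] lookup_eq[symmetric] del: funpow.simps split: if_splits)
next
  case (Prod_Prop A \<Delta> P)
  have "lift n A # \<Delta>' \<turnstile> lift (Suc n) P \<Colon> lift (Suc n) Prop"
    by (intro Prod_Prop ins_Suc)
  then show ?case by (auto intro: typing.Prod_Prop)
next
  case (Prod_Type \<Delta> A j B)
  have "lift n A # \<Delta>' \<turnstile> lift (Suc n) B \<Colon> lift (Suc n) (Type j)" "\<Delta>' \<turnstile> lift n A \<Colon> lift n (Type j)"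
    by (intro Prod_Type ins_Suc)+
  then show ?case by (auto intro: typing.Prod_Type)
next
  case (Lam A \<Delta> M B)
  have "lift n A # \<Delta>' \<turnstile> lift (Suc n) M \<Colon> lift (Suc n) B"
    by (intro Lam ins_Suc)
  then show ?case by (auto intro: typing.Lam)
next
  case (App \<Delta> M A B N)
  have "\<Delta>' \<turnstile> lift n M \<Colon> lift n (Prod A B)" "\<Delta>' \<turnstile> lift n N \<Colon> lift n A"
    by (intro App)+
  then show ?case by (auto simp: lift_subst_ge intro: typing.App)
next
  case (Sig \<Delta> A j B)
  have "lift n A # \<Delta>' \<turnstile> lift (Suc n) B \<Colon> lift (Suc n) (Type j)" "\<Delta>' \<turnstile> lift n A \<Colon> lift n (Type j)"
    by (intro Sig ins_Suc)+
  then show ?case by (auto intro: typing.Sig)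
next
  case (Pair \<Delta> M A N B j)
  have "lift n A # \<Delta>' \<turnstile> lift (Suc n) B \<Colon> lift (Suc n) (Type j)" "\<Delta>' \<turnstile> lift n M \<Colon> lift n A"
    "\<Delta>' \<turnstile> lift n N \<Colon> lift n (subst 0 M B)"
    by (intro Pair ins_Suc)+
  then show ?case by (auto simp: lift_subst_ge intro: typing.Pair)
next
  case (Proj1 \<Delta> M A B)
  have "\<Delta>' \<turnstile> lift n M \<Colon> lift n (Sig A B)" by (intro Proj1)
  then show ?case by (auto intro: typing.Proj1)
next
  case (Proj2 \<Delta> M A B)
  have "\<Delta>' \<turnstile> lift n M \<Colon> lift n (Sig A B)" by (intro Proj2)
  then show ?case by (auto simp: lift_subst_ge intro: typing.Proj2)
next
  case (Cumul \<Delta> M A A' j)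
  have "\<Delta>' \<turnstile> lift n A' \<Colon> lift n (Type j)" "\<Delta>' \<turnstile> lift n M \<Colon> lift n A" by (intro Cumul)+
  with cumul_lift[OF Cumul.hyps(3)] show ?case by (auto intro: typing.Cumul)
qed

lemma weakening_0: "\<Gamma> \<turnstile> M \<Colon> A \<Longrightarrow> \<Gamma> \<turnstile> C \<Colon> Type k \<Longrightarrow> C # \<Gamma> \<turnstile> lift 0 M \<Colon> lift 0 A"
  using weakening ctx_ins.ins_0 by blast

text \<open>The term \<open>N\<close> is given in the resulting context, hence lifted whenever that is extended.\<close>

inductive ctx_sub :: "tm \<Rightarrow> tm list \<Rightarrow> nat \<Rightarrow> tm \<Rightarrow> tm list \<Rightarrow> tm list \<Rightarrow> bool" for T \<Gamma> where
  sub_0: "\<Gamma> \<turnstile> N \<Colon> T \<Longrightarrow> ctx_sub T \<Gamma> 0 N (T # \<Gamma>) \<Gamma>"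
| sub_Suc: "ctx_sub T \<Gamma> n N \<Delta> \<Delta>' \<Longrightarrow> ctx_sub T \<Gamma> (Suc n) (lift 0 N) (A # \<Delta>) (subst n N A # \<Delta>')"

lemma ctx_sub_length: "ctx_sub T \<Gamma> n N \<Delta> \<Delta>' \<Longrightarrow> length \<Delta> = Suc (length \<Delta>') \<and> n \<le> length \<Delta>'"
  by (induction rule: ctx_sub.induct) auto

lemma ctx_sub_lookup:
  "ctx_sub T \<Gamma> n N \<Delta> \<Delta>' \<Longrightarrow> i < length \<Delta> \<Longrightarrow> i \<noteq> n \<Longrightarrow>
     lookup \<Delta>' (if i < n then i else i - 1) = subst n N (lookup \<Delta> i)"
proof (induction arbitrary: i rule: ctx_sub.induct)
  case (sub_0 N)
  then show ?case by (cases i) auto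
next
  case (sub_Suc n N \<Delta> \<Delta>' A)
  show ?case
  proof (cases i)
    case (Suc i')
    with sub_Suc.IH[of i'] sub_Suc.prems show ?thesis
      by (cases "i' < n"; cases i') (simp_all add: subst_lift_Suc[of 0 n])
  qed (simp add: subst_lift_Suc[of 0 n])
qed

text \<open>Supplies the case of the substituted variable itself: \<open>N\<close> is typed over
  \<open>\<Gamma>\<close>, and weakening carries it through the later entries.\<close>

lemma ctx_sub_typing:
  "ctx_sub T \<Gamma> n N \<Delta> \<Delta>' \<Longrightarrow> \<Delta>' \<turnstile> Prop \<Colon> Type 0 \<Longrightarrow> \<Delta>' \<turnstile> N \<Colon> subst n N (lookup \<Delta> n)"
proof (induction rule: ctx_sub.induct)
  case (sub_Suc n N \<Delta> \<Delta>' A)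
  then have "\<Delta>' \<turnstile> N \<Colon> subst n N (lookup \<Delta> n)" "\<exists>j. \<Delta>' \<turnstile> subst n N A \<Colon> Type j"
    using ctx_ConsD by blast+
  then show ?case by (auto simp: subst_lift_Suc intro: weakening_0)
qed simp

theorem substitution:
  "\<Delta> \<turnstile> M \<Colon> A \<Longrightarrow> ctx_sub T \<Gamma> n N \<Delta> \<Delta>' \<Longrightarrow> \<Delta>' \<turnstile> subst n N M \<Colon> subst n N A"
proof (induction arbitrary: n N \<Delta>' rule: typing.induct)
  case Ax
  then show ?case by (auto elim: ctx_sub.cases)
next
  case (Ext \<Delta> A j)
  from Ext.prems(1) show ?case
  proof cases
    case sub_0
    \<comment> \<open>The substituted variable is the latest one, so the remaining context is the
      one in which its type was formed.\<close>
    with Ext.hyps show ?thesis by (auto intro: ctx_valid)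
  next
    case (sub_Suc n' N' \<Delta>'')
    with Ext.IH[OF sub_Suc(4)] show ?thesis by (auto intro: typing.Ext)
  qed
next
  case (Type \<Delta> j)
  then show ?case by (auto intro: typing.Type)
next
  case (Var \<Delta> i)
  have v: "\<Delta>' \<turnstile> Prop \<Colon> Type 0" using Var.IH[OF Var.prems] by simp
  show ?case
  proof (cases "i = n")
    case True
    with ctx_sub_typing[OF Var.prems v] Var.hyps(2) show ?thesis
      by (simp add: lookup_eq del: funpow.simps)
  next
    case False
    then show ?thesis
      using Var_lookup[OF v, of "if i < n then i else i - 1"] ctx_sub_length[OF Var.prems] Var.hyps(2)
      by (auto simp: ctx_sub_lookup[OF Var.prems] lookup_eq[symmetric] simp del: funpow.simps
          split: if_splits)
  qed
next
  case (Prod_Prop A \<Delta> P)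
  have "subst n N A # \<Delta>' \<turnstile> subst (Suc n) (lift 0 N) P \<Colon> subst (Suc n) (lift 0 N) Prop"
    by (intro Prod_Prop sub_Suc)
  then show ?case by (auto intro: typing.Prod_Prop)
next
  case (Prod_Type \<Delta> A j B)
  have "subst n N A # \<Delta>' \<turnstile> subst (Suc n) (lift 0 N) B \<Colon> subst (Suc n) (lift 0 N) (Type j)"
    "\<Delta>' \<turnstile> subst n N A \<Colon> subst n N (Type j)"
    by (intro Prod_Type sub_Suc)+
  then show ?case by (auto intro: typing.Prod_Type)
next
  case (Lam A \<Delta> M B)
  have "subst n N A # \<Delta>' \<turnstile> subst (Suc n) (lift 0 N) M \<Colon> subst (Suc n) (lift 0 N) B"
    by (intro Lam sub_Suc)
  then show ?case by (auto intro: typing.Lam)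
next
  case (App \<Delta> M A B M')
  have "\<Delta>' \<turnstile> subst n N M \<Colon> subst n N (Prod A B)" "\<Delta>' \<turnstile> subst n N M' \<Colon> subst n N A"
    by (intro App)+
  then show ?case by (auto simp: subst_subst intro: typing.App)
next
  case (Sig \<Delta> A j B)
  have "subst n N A # \<Delta>' \<turnstile> subst (Suc n) (lift 0 N) B \<Colon> subst (Suc n) (lift 0 N) (Type j)"
    "\<Delta>' \<turnstile> subst n N A \<Colon> subst n N (Type j)"
    by (intro Sig sub_Suc)+
  then show ?case by (auto intro: typing.Sig)
next
  case (Pair \<Delta> M A M' B j)
  have "subst n N A # \<Delta>' \<turnstile> subst (Suc n) (lift 0 N) B \<Colon> subst (Suc n) (lift 0 N) (Type j)"
    "\<Delta>' \<turnstile> subst n N M \<Colon> subst n N A" "\<Delta>' \<turnstile> subst n N M' \<Colon> subst n N (subst 0 M B)"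
    by (intro Pair sub_Suc)+
  then show ?case by (auto simp: subst_subst intro: typing.Pair)
next
  case (Proj1 \<Delta> M A B)
  have "\<Delta>' \<turnstile> subst n N M \<Colon> subst n N (Sig A B)" by (intro Proj1)
  then show ?case by (auto intro: typing.Proj1)
next
  case (Proj2 \<Delta> M A B)
  have "\<Delta>' \<turnstile> subst n N M \<Colon> subst n N (Sig A B)" by (intro Proj2)
  then show ?case by (auto simp: subst_subst intro: typing.Proj2)
next
  case (Cumul \<Delta> M A A' j)
  have "\<Delta>' \<turnstile> subst n N A' \<Colon> subst n N (Type j)" "\<Delta>' \<turnstile> subst n N M \<Colon> subst n N A"
    by (intro Cumul)+
  with cumul_subst[OF Cumul.hyps(3)] show ?case by (auto intro: typing.Cumul)
qed

lemma substitution_0: "T # \<Gamma> \<turnstile> M \<Colon> A \<Longrightarrow> \<Gamma> \<turnstile> N \<Colon> T \<Longrightarrow> \<Gamma> \<turnstile> subst 0 N M \<Colon> subst 0 N A"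
  using substitution ctx_sub.sub_0 by blast


section \<open>Subject reduction\<close>

text \<open>Generation, here and in the next lemmas: a derivation is one syntax-directed rule
  followed by uses of \<open>Cumul\<close>, so every type of the term lies above the one given by
  that rule.\<close>

lemma gen_Prop: "\<Gamma> \<turnstile> M \<Colon> C \<Longrightarrow> M = Prop \<Longrightarrow> Type 0 \<preceq> C"
  by (induction rule: typing.induct) (auto intro: cumul.trans)

lemma gen_Type: "\<Gamma> \<turnstile> M \<Colon> C \<Longrightarrow> M = Type j \<Longrightarrow> Type (Suc j) \<preceq> C"
  by (induction rule: typing.induct) (auto intro: cumul.trans)

lemma gen_Var: "\<Gamma> \<turnstile> M \<Colon> C \<Longrightarrow> M = Var i \<Longrightarrow> lookup \<Gamma> i \<preceq> C"
  by (induction rule: typing.induct) (auto simp: lookup_eq intro: cumul.trans)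

text \<open>The two disjuncts are the impredicative and the predicative formation rule; in the
  impredicative one the universe of the domain is unconstrained.\<close>

lemma gen_Prod: "\<Gamma> \<turnstile> M \<Colon> C \<Longrightarrow> M = Prod A B \<Longrightarrow>
   A # \<Gamma> \<turnstile> B \<Colon> Prop \<and> Prop \<preceq> C \<or> (\<exists>j. \<Gamma> \<turnstile> A \<Colon> Type j \<and> A # \<Gamma> \<turnstile> B \<Colon> Type j \<and> Type j \<preceq> C)"
  by (induction rule: typing.induct) (auto intro: cumul.trans)

lemma gen_Sig: "\<Gamma> \<turnstile> M \<Colon> C \<Longrightarrow> M = Sig A B \<Longrightarrow>
   \<exists>j. \<Gamma> \<turnstile> A \<Colon> Type j \<and> A # \<Gamma> \<turnstile> B \<Colon> Type j \<and> Type j \<preceq> C"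
  by (induction rule: typing.induct) (auto intro: cumul.trans)

lemma gen_Lam: "\<Gamma> \<turnstile> M \<Colon> C \<Longrightarrow> M = Lam A N \<Longrightarrow> \<exists>B. A # \<Gamma> \<turnstile> N \<Colon> B \<and> Prod A B \<preceq> C"
  by (induction rule: typing.induct) (auto intro: cumul.trans)

lemma gen_App: "\<Gamma> \<turnstile> M \<Colon> C \<Longrightarrow> M = App N N' \<Longrightarrow>
   \<exists>A B. \<Gamma> \<turnstile> N \<Colon> Prod A B \<and> \<Gamma> \<turnstile> N' \<Colon> A \<and> subst 0 N' B \<preceq> C"
  by (induction rule: typing.induct) (auto intro: cumul.trans, meson cumul_refl)

lemma gen_MkPair: "\<Gamma> \<turnstile> M \<Colon> C \<Longrightarrow> M = MkPair S N N' \<Longrightarrow>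
   \<exists>A B. \<Gamma> \<turnstile> N \<Colon> A \<and> \<Gamma> \<turnstile> N' \<Colon> subst 0 N B \<and> Sig A B \<preceq> C"
  by (induction rule: typing.induct) (auto intro: cumul.trans, meson cumul_refl)

section \<open>Every type of a term is itself typed by a universe\<close>

lemma lookup_Type: "\<Gamma> \<turnstile> Prop \<Colon> Type 0 \<Longrightarrow> i < length \<Gamma> \<Longrightarrow> \<exists>j. \<Gamma> \<turnstile> lookup \<Gamma> i \<Colon> Type j"
proof (induction \<Gamma> i rule: lookup.induct)
  case (2 A \<Gamma>)
  with ctx_ConsD obtain j where "\<Gamma> \<turnstile> A \<Colon> Type j" by blast
  with weakening_0[OF this this] show ?case by auto
next
  case (3 A \<Gamma> i)
  with ctx_ConsD obtain j where A: "\<Gamma> \<turnstile> A \<Colon> Type j" and "\<Gamma> \<turnstile> Prop \<Colon> Type 0" by blast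
  with 3 obtain k where "\<Gamma> \<turnstile> lookup \<Gamma> i \<Colon> Type k" by auto
  from weakening_0[OF this A] show ?case by auto
qed simp

lemma Prod_family_Type:
  assumes "\<Gamma> \<turnstile> Prod A B \<Colon> C"
  obtains j where "A # \<Gamma> \<turnstile> B \<Colon> Type j"
  using gen_Prod[OF assms refl] Prop_imp_Type that by metis

lemma Sig_family_Type:
  assumes "\<Gamma> \<turnstile> Sig A B \<Colon> C"
  obtains j where "\<Gamma> \<turnstile> A \<Colon> Type j" "A # \<Gamma> \<turnstile> B \<Colon> Type j"
  using gen_Sig[OF assms refl] that by metis

text \<open>For eliminators, generation on the product or sum type recovers its components, and the
  substitution theorem instantiates a dependent family at the argument or first projection.\<close>

theorem type_correctness: "\<Gamma> \<turnstile> M \<Colon> A \<Longrightarrow> \<exists>j. \<Gamma> \<turnstile> A \<Colon> Type j"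
proof (induction rule: typing.induct)
  case (Var \<Gamma> i)
  then show ?case using lookup_Type[of \<Gamma> i] by (simp add: lookup_eq del: funpow.simps)
next
  case (Prod_Prop A \<Gamma> P)
  then show ?case using typing.Ext ctx_ConsD[OF Prod_Prop.hyps] by blast
next
  case (Lam A \<Gamma> M B)
  then obtain j where "A # \<Gamma> \<turnstile> B \<Colon> Type j" by blast
  moreover from ctx_ConsD[OF Lam.hyps] obtain i where "\<Gamma> \<turnstile> A \<Colon> Type i" by blast
  ultimately show ?case using Prod_Type_max by blast
next
  case (App \<Gamma> M A B N)
  then obtain k where "\<Gamma> \<turnstile> Prod A B \<Colon> Type k" by blast
  then obtain j where "A # \<Gamma> \<turnstile> B \<Colon> Type j" by (rule Prod_family_Type)
  from substitution_0[OF this App.hyps(2)] show ?case by auto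
next
  case (Pair \<Gamma> M A N B j)
  from ctx_ConsD[OF Pair.hyps(3)] obtain i where "\<Gamma> \<turnstile> A \<Colon> Type i" by blast
  from Sig_Type_max[OF this Pair.hyps(3)] show ?case by blast
next
  case (Proj1 \<Gamma> M A B)
  then obtain k where "\<Gamma> \<turnstile> Sig A B \<Colon> Type k" by blast
  then obtain j where "\<Gamma> \<turnstile> A \<Colon> Type j" by (rule Sig_family_Type)
  then show ?case by blast
next
  case (Proj2 \<Gamma> M A B)
  then obtain k where "\<Gamma> \<turnstile> Sig A B \<Colon> Type k" by blast
  then obtain j where "A # \<Gamma> \<turnstile> B \<Colon> Type j" by (rule Sig_family_Type)
  from substitution_0[OF this typing.Proj1[OF Proj2.hyps]] show ?case by auto
next
  case Ax
  then show ?case using typing.Type[OF typing.Ax] by blast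
next
  case (Ext \<Gamma> A j)
  then show ?case using typing.Type[OF typing.Ext] by blast
next
  case (Type \<Gamma> j)
  then show ?case using typing.Type by blast
next
  case (Prod_Type \<Gamma> A j B)
  then show ?case using typing.Type[OF ctx_valid] by blast
next
  case (Sig \<Gamma> A j B)
  then show ?case using typing.Type[OF ctx_valid] by blast
qed blast

section \<open>Preservation of types under reduction of terms and of contexts\<close>

inductive ctx_red :: "tm list \<Rightarrow> tm list \<Rightarrow> bool" where
  ctx_red_0: "red A A' \<Longrightarrow> ctx_red (A # \<Gamma>) (A' # \<Gamma>)"
| ctx_red_Suc: "ctx_red \<Gamma> \<Gamma>' \<Longrightarrow> ctx_red (A # \<Gamma>) (A # \<Gamma>')"

inductive_cases ctx_red_ConsE: "ctx_red (A # \<Gamma>) \<Delta>"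

lemma ctx_red_length: "ctx_red \<Gamma> \<Gamma>' \<Longrightarrow> length \<Gamma>' = length \<Gamma>"
  by (induction rule: ctx_red.induct) auto

text \<open>The first conjunct serves the conversion rule, which asks that the old type still be a
  type over the reduced context.\<close>

lemma ctx_red_lookup:
  "ctx_red \<Gamma> \<Gamma>' \<Longrightarrow> \<Gamma> \<turnstile> Prop \<Colon> Type 0 \<Longrightarrow> \<Gamma>' \<turnstile> Prop \<Colon> Type 0 \<Longrightarrow> i < length \<Gamma> \<Longrightarrow>
     (\<exists>j. \<Gamma>' \<turnstile> lookup \<Gamma> i \<Colon> Type j) \<and> lookup \<Gamma>' i \<simeq> lookup \<Gamma> i"
proof (induction arbitrary: i rule: ctx_red.induct)
  case (ctx_red_0 A A' \<Gamma>)
  then obtain j k where A: "\<Gamma> \<turnstile> A \<Colon> Type j" "\<Gamma> \<turnstile> A' \<Colon> Type k" and v: "\<Gamma> \<turnstile> Prop \<Colon> Type 0"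
    using ctx_ConsD by meson
  show ?case
  proof (cases i)
    case 0
    then show ?thesis
      using weakening_0[OF A] conv_lift[of A' A] ctx_red_0.hyps by auto
  next
    case (Suc i')
    with ctx_red_0.prems lookup_Type[OF v, of i'] obtain l where "\<Gamma> \<turnstile> lookup \<Gamma> i' \<Colon> Type l" by auto
    from weakening_0[OF this A(2)] Suc show ?thesis by auto
  qed
next
  case (ctx_red_Suc \<Gamma> \<Gamma>' A)
  then obtain j where A: "\<Gamma>' \<turnstile> A \<Colon> Type j" and v: "\<Gamma> \<turnstile> Prop \<Colon> Type 0" "\<Gamma>' \<turnstile> Prop \<Colon> Type 0"
    using ctx_ConsD by meson
  show ?case
  proof (cases i)
    case 0
    then show ?thesis using weakening_0[OF A A] by auto
  next
    case (Suc i')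
    with ctx_red_Suc.prems ctx_red_Suc.IH[OF v, of i'] obtain l
      where l: "\<Gamma>' \<turnstile> lookup \<Gamma> i' \<Colon> Type l" "lookup \<Gamma>' i' \<simeq> lookup \<Gamma> i'" by auto
    from weakening_0[OF l(1) A] Suc conv_lift[OF l(2)] show ?thesis by auto
  qed
qed

lemma typing_conv: "\<Gamma> \<turnstile> M \<Colon> A \<Longrightarrow> \<Gamma> \<turnstile> A' \<Colon> Type j \<Longrightarrow> A \<simeq> A' \<Longrightarrow> \<Gamma> \<turnstile> M \<Colon> A'"
  by (blast intro: typing.Cumul cumul.conv)

text \<open>Reduction of the context has to be treated at the same time, because of the annotations of
  binders.\<close>

theorem subject_reduction_ctx:
  "\<Gamma> \<turnstile> M \<Colon> A \<Longrightarrow> (\<forall>M'. red M M' \<longrightarrow> \<Gamma> \<turnstile> M' \<Colon> A) \<and> (\<forall>\<Gamma>'. ctx_red \<Gamma> \<Gamma>' \<longrightarrow> \<Gamma>' \<turnstile> M \<Colon> A)"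
proof (induction rule: typing.induct)
  case Ax
  then show ?case by (auto elim: red_PropE ctx_red.cases intro: typing.Ax)
next
  case (Ext \<Gamma> A j)
  then show ?case by (auto elim!: red_PropE ctx_red_ConsE intro: typing.Ext)
next
  case (Type \<Gamma> j)
  then show ?case by (auto elim: red_TypeE intro: typing.Type)
next
  case (Var \<Gamma> i)
  have "\<Gamma>' \<turnstile> Var i \<Colon> lookup \<Gamma> i" if r: "ctx_red \<Gamma> \<Gamma>'" for \<Gamma>'
  proof -
    have v: "\<Gamma>' \<turnstile> Prop \<Colon> Type 0" using Var.IH r by auto
    from ctx_red_lookup[OF r Var.hyps(1) v Var.hyps(2)] obtain j
      where "\<Gamma>' \<turnstile> lookup \<Gamma> i \<Colon> Type j" "lookup \<Gamma>' i \<simeq> lookup \<Gamma> i" by blast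
    with Var_lookup[OF v, of i] ctx_red_length[OF r] Var.hyps(2) show ?thesis
      by (auto intro: typing_conv)
  qed
  with Var.hyps(2) show ?case by (auto simp: lookup_eq simp del: funpow.simps elim: red_VarE)
next
  case (Prod_Prop A \<Gamma> P)
  then show ?case by (auto elim!: red_ProdE intro: typing.Prod_Prop ctx_red.intros)
next
  case (Prod_Type \<Gamma> A j B)
  then show ?case by (auto elim!: red_ProdE intro!: typing.Prod_Type intro: ctx_red.intros)
next
  case (Lam A \<Gamma> M B)
  from type_correctness[OF typing.Lam[OF Lam.hyps]] obtain k where k: "\<Gamma> \<turnstile> Prod A B \<Colon> Type k" by blast
  \<comment> \<open>Reducing the annotation also changes the domain of the type that
    \<open>Lam\<close> yields; conversion restores the original type.\<close>
  have "\<Gamma> \<turnstile> Lam A' M \<Colon> Prod A B" if "red A A'" for A'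
  proof -
    have "\<Gamma> \<turnstile> Lam A' M \<Colon> Prod A' B" using Lam.IH that by (auto intro: typing.Lam ctx_red.intros)
    moreover have "red (Prod A B) (Prod A' B)" using that by (rule red.intros)
    ultimately show ?thesis using k by (auto intro: typing_conv)
  qed
  with Lam.IH show ?case by (auto elim!: red_LamE intro: typing.Lam ctx_red.intros)
next
  case (App \<Gamma> M A B N)
  from type_correctness[OF typing.App[OF App.hyps]] obtain k where k: "\<Gamma> \<turnstile> subst 0 N B \<Colon> Type k" by blast
  \<comment> \<open>The annotation \<open>A'\<close> of the abstraction need only be convertible to
    \<open>A\<close>, and the type of its body need only lie below \<open>B\<close>. Since
    cumulativity leaves domains invariant, the argument can be retyped at \<open>A'\<close> and
    substituted.\<close>
  have beta: "\<Gamma> \<turnstile> subst 0 N M' \<Colon> subst 0 N B" if M: "M = Lam A' M'" for A' M'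
  proof -
    from gen_Lam[OF App.hyps(1) M] obtain B' where B': "A' # \<Gamma> \<turnstile> M' \<Colon> B'" "Prod A' B' \<preceq> Prod A B" by blast
    then obtain l where "\<Gamma> \<turnstile> A' \<Colon> Type l" using ctx_ConsD by blast
    with App.hyps(2) cumul_ProdD[OF B'(2)] have "\<Gamma> \<turnstile> N \<Colon> A'"
      by (auto intro: typing_conv equivclp_sym)
    from substitution_0[OF B'(1) this] k cumul_subst[of B' B] cumul_ProdD[OF B'(2)] show ?thesis
      by (auto intro: typing.Cumul)
  qed
  have "\<Gamma> \<turnstile> App M N' \<Colon> subst 0 N B" if "red N N'" for N'
  proof -
    have "\<Gamma> \<turnstile> App M N' \<Colon> subst 0 N' B" using App that by (auto intro: typing.App)
    then show ?thesis using k red_conv_subst[OF that] by (auto intro: typing_conv equivclp_sym)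
  qed
  with App beta show ?case by (auto elim!: red_AppE intro: typing.App)
next
  case (Sig \<Gamma> A j B)
  then show ?case by (auto elim!: red_SigE intro!: typing.Sig intro: ctx_red.intros)
next
  case (Pair \<Gamma> M A N B j)
  from type_correctness[OF typing.Pair[OF Pair.hyps]] obtain k where k: "\<Gamma> \<turnstile> Sig A B \<Colon> Type k" by blast
  have 1: "\<Gamma> \<turnstile> MkPair (Sig A' B) M N \<Colon> Sig A B" if r: "red A A'" for A'
  proof -
    have B: "A' # \<Gamma> \<turnstile> B \<Colon> Type j" using Pair.IH r by (auto intro: ctx_red.intros)
    then obtain l where "\<Gamma> \<turnstile> A' \<Colon> Type l" using ctx_ConsD by blast
    with r Pair.hyps(1) have "\<Gamma> \<turnstile> M \<Colon> A'" by (auto intro: typing_conv)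
    with B Pair.hyps have "\<Gamma> \<turnstile> MkPair (Sig A' B) M N \<Colon> Sig A' B" by (auto intro: typing.Pair)
    moreover have "red (Sig A B) (Sig A' B)" using r by (rule red.intros)
    ultimately show ?thesis using k by (auto intro: typing_conv)
  qed
  have 2: "\<Gamma> \<turnstile> MkPair (Sig A B') M N \<Colon> Sig A B" if r: "red B B'" for B'
  proof -
    have B: "A # \<Gamma> \<turnstile> B' \<Colon> Type j" using Pair.IH r by auto
    from substitution_0[OF this Pair.hyps(1)] Pair.hyps(2) red_subst[OF r]
    have "\<Gamma> \<turnstile> N \<Colon> subst 0 M B'" by (auto intro: typing_conv)
    with B Pair.hyps have "\<Gamma> \<turnstile> MkPair (Sig A B') M N \<Colon> Sig A B'" by (auto intro: typing.Pair)
    moreover have "red (Sig A B) (Sig A B')" using r by (rule red.intros)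
    ultimately show ?thesis using k by (auto intro: typing_conv)
  qed
  \<comment> \<open>A step in the first component changes the type required of the second one, but
    only up to conversion.\<close>
  have 3: "\<Gamma> \<turnstile> MkPair (Sig A B) M' N \<Colon> Sig A B" if r: "red M M'" for M'
  proof -
    have M': "\<Gamma> \<turnstile> M' \<Colon> A" using Pair.IH r by auto
    from substitution_0[OF Pair.hyps(3) this] Pair.hyps(2) red_conv_subst[OF r]
    have "\<Gamma> \<turnstile> N \<Colon> subst 0 M' B" by (auto intro: typing_conv)
    with M' Pair.hyps show ?thesis by (auto intro: typing.Pair)
  qed
  have "\<Gamma>' \<turnstile> MkPair (Sig A B) M N \<Colon> Sig A B" if "ctx_red \<Gamma> \<Gamma>'" for \<Gamma>'
    by (rule typing.Pair[of _ _ _ _ _ j]) (use Pair.IH that in \<open>auto intro: ctx_red.intros\<close>)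
  then show ?case
    using 1 2 3 Pair.IH Pair.hyps
    by (auto elim!: red_MkPairE red_SigE intro: typing.Pair ctx_red.intros)
next
  case (Proj1 \<Gamma> M A B)
  have "\<Gamma> \<turnstile> N \<Colon> A" if M: "M = MkPair S N N'" for S N N'
  proof -
    from gen_MkPair[OF Proj1.hyps M] obtain A' B' where "\<Gamma> \<turnstile> N \<Colon> A'" "Sig A' B' \<preceq> Sig A B" by blast
    moreover obtain j where "\<Gamma> \<turnstile> A \<Colon> Type j" using type_correctness[OF Proj1.hyps] Sig_family_Type by blast
    ultimately show ?thesis by (auto dest: cumul_SigD intro: typing.Cumul)
  qed
  with Proj1.IH show ?case by (auto elim!: red_Proj1E intro: typing.Proj1)
next
  case (Proj2 \<Gamma> M A B)
  from type_correctness[OF typing.Proj2[OF Proj2.hyps]] obtain k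
    where k: "\<Gamma> \<turnstile> subst 0 (Proj1 M) B \<Colon> Type k" by blast
  have 1: "\<Gamma> \<turnstile> N' \<Colon> subst 0 (Proj1 M) B" if M: "M = MkPair S N N'" for S N N'
  proof -
    from gen_MkPair[OF Proj2.hyps M] obtain A' B'
      where N: "\<Gamma> \<turnstile> N' \<Colon> subst 0 N B'" "Sig A' B' \<preceq> Sig A B" by blast
    have "subst 0 N B' \<preceq> subst 0 N B" using N(2) by (auto dest: cumul_SigD intro: cumul_subst)
    \<comment> \<open>Generation types the second component over \<open>N\<close>, whereas the
      projection rule uses \<open>Proj1 M\<close>; the latter reduces to \<open>N\<close>.\<close>
    moreover have "subst 0 N B \<preceq> subst 0 (Proj1 M) B"
      unfolding M by (intro cumul.conv equivclp_sym[OF red_conv_subst] red.proj1)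
    ultimately show ?thesis using N(1) k by (blast intro: typing.Cumul cumul.trans)
  qed
  have "\<Gamma> \<turnstile> Proj2 M' \<Colon> subst 0 (Proj1 M) B" if r: "red M M'" for M'
  proof -
    have "\<Gamma> \<turnstile> Proj2 M' \<Colon> subst 0 (Proj1 M') B" using Proj2.IH r by (auto intro: typing.Proj2)
    moreover have "red (Proj1 M) (Proj1 M')" using r by (rule red.intros)
    ultimately show ?thesis using k by (auto intro: typing_conv equivclp_sym[OF red_conv_subst])
  qed
  with 1 Proj2.IH show ?case by (auto elim!: red_Proj2E intro: typing.Proj2)
next
  case (Cumul \<Gamma> M A A' j)
  then show ?case by (blast intro: typing.Cumul)
qed

lemma subject_reduction: "red\<^sup>*\<^sup>* M M' \<Longrightarrow> \<Gamma> \<turnstile> M \<Colon> A \<Longrightarrow> \<Gamma> \<turnstile> M' \<Colon> A"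
  by (induction rule: rtranclp_induct) (auto dest: subject_reduction_ctx)


section \<open>Terms that are not proofs\<close>

lemma univ_not_prop [simp]: "\<not> is_prop \<Gamma> Prop" "\<not> is_prop \<Gamma> (Type j)"
  using gen_Prop[OF _ refl, of \<Gamma> Prop] gen_Type[OF _ refl, of \<Gamma> j Prop] by (auto simp: is_prop_def)

text \<open>By confluence a term convertible to a universe reduces to it, and subject reduction
  would then make that universe a proposition.\<close>

lemma prop_not_conv_univ: "is_prop \<Gamma> P \<Longrightarrow> \<not> conv_univ P"
  unfolding conv_univ_def conv_Prop_iff conv_Type_iff
  using subject_reduction univ_not_prop unfolding is_prop_def by blast

text \<open>All types of \<open>Prop\<close> lie above a universe, hence are convertible to
  universes, which no proposition is. Results of this kind exclude the first branch of
  \<open>interp\<close>, so that the structural clause applies.\<close>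

lemma Prop_not_proof [simp]: "\<not> is_proof \<Gamma> Prop"
  unfolding is_proof_def
  using gen_Prop[OF _ refl] cumul_conv_univ prop_not_conv_univ conv_univ_simps(2) by blast

lemma Prod_not_proof [simp]: "\<not> is_proof \<Gamma> (Prod A B)"
  unfolding is_proof_def
  using gen_Prod[OF _ refl] cumul_conv_univ prop_not_conv_univ conv_univ_simps(1,2) by blast

lemma Var_Prop_not_proof: "lookup \<Gamma> i = Prop \<Longrightarrow> \<not> is_proof \<Gamma> (Var i)"
  unfolding is_proof_def
  using gen_Var[OF _ refl, of \<Gamma> i] cumul_conv_univ prop_not_conv_univ conv_univ_simps(1) by metis

lemma Var_predicate_not_proof:
  assumes "lookup \<Gamma> i = Prod A Prop"
  shows "\<not> is_proof \<Gamma> (Var i)"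
proof
  assume "is_proof \<Gamma> (Var i)"
  then obtain P where P: "is_prop \<Gamma> P" "Prod A Prop \<preceq> P"
    unfolding is_proof_def using gen_Var[OF _ refl, of \<Gamma> i] assms by auto
  then obtain A' B' where B': "P \<simeq> Prod A' B'" "Prop \<preceq> B'"
    using cumul_Prod_left[OF P(2) equivclp_refl] by blast
  \<comment> \<open>Subject reduction keeps \<open>P\<close> a proposition along its own reductions
    but says nothing about the converted product, so the argument moves to a common reduct. Its
    codomain is a universe up to conversion and, by generation, also a proposition.\<close>
  then obtain K where K: "red\<^sup>*\<^sup>* P K" "red\<^sup>*\<^sup>* (Prod A' B') K" by (auto simp: conv_iff_joinable)
  then obtain A'' B'' where K': "K = Prod A'' B''" "red\<^sup>*\<^sup>* B' B''" by (blast dest: reds_ProdD)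
  have "conv_univ B''"
    using cumul_conv_univ[OF B'(2)] conv_univ_cong[OF rtranclp_into_equivclp[of red, OF K'(2)]] by simp
  moreover have "\<Gamma> \<turnstile> Prod A'' B'' \<Colon> Prop"
    using subject_reduction K P(1) K'(1) by (auto simp: is_prop_def)
  then have "is_prop (A'' # \<Gamma>) B''" using gen_Prod[OF _ refl, of \<Gamma> A'' B'' Prop] by (auto simp: is_prop_def)
  ultimately show False using prop_not_conv_univ by blast
qed

lemma App_predicate_not_proof:
  assumes "lookup \<Gamma> i = Prod A Prop"
  shows "\<not> is_proof \<Gamma> (App (Var i) N)"
proof
  assume "is_proof \<Gamma> (App (Var i) N)"
  then obtain P A' B' where P: "is_prop \<Gamma> P" "\<Gamma> \<turnstile> Var i \<Colon> Prod A' B'" "subst 0 N B' \<preceq> P"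
    unfolding is_proof_def using gen_App[OF _ refl] by blast
  \<comment> \<open>The codomain used for the application lies above \<open>Prop\<close>, and being
    convertible to a universe survives the instantiation by \<open>N\<close>.\<close>
  from gen_Var[OF P(2) refl] have "Prop \<preceq> B'" using cumul_ProdD assms by simp
  then have "conv_univ (subst 0 N B')" using cumul_conv_univ conv_univ_subst by simp
  from cumul_conv_univ[OF P(3) this] prop_not_conv_univ[OF P(1)] show False by blast
qed

lemma Prod_Prop_not_prop [simp]: "\<not> is_prop \<Gamma> (Prod A Prop)"
proof
  assume "is_prop \<Gamma> (Prod A Prop)"
  then have "is_prop (A # \<Gamma>) Prop" using gen_Prod[OF _ refl, of \<Gamma> A Prop Prop] by (auto simp: is_prop_def)
  then show False by simp
qed


section \<open>Strengthening by inhabited types\<close>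

text \<open>Substituting an inhabitant of the inserted type undoes the insertion; the iterated
  lifting is that inhabitant read below the \<open>n\<close> later variables.\<close>

lemma ctx_ins_imp_ctx_sub:
  "ctx_ins C \<Gamma> n \<Delta> \<Delta>' \<Longrightarrow> \<Gamma> \<turnstile> N \<Colon> C \<Longrightarrow> ctx_sub C \<Gamma> n ((lift 0 ^^ n) N) \<Delta>' \<Delta>"
proof (induction rule: ctx_ins.induct)
  case (ins_Suc n \<Delta> \<Delta>' A)
  then have "ctx_sub C \<Gamma> (Suc n) (lift 0 ((lift 0 ^^ n) N)) (lift n A # \<Delta>')
      (subst n ((lift 0 ^^ n) N) (lift n A) # \<Delta>)"
    by (intro sub_Suc) simp
  then show ?case by simp
qed (simp add: sub_0)

lemma strengthening:
  assumes "ctx_ins C \<Gamma> n \<Delta> \<Delta>'" "\<Gamma> \<turnstile> N \<Colon> C" "\<Delta>' \<turnstile> lift n M \<Colon> A"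
  shows "\<Delta> \<turnstile> M \<Colon> subst n ((lift 0 ^^ n) N) A"
  using substitution[OF assms(3) ctx_ins_imp_ctx_sub[OF assms(1,2)]] by simp

lemma is_prop_lift_iff:
  assumes "ctx_ins C \<Gamma> n \<Delta> \<Delta>'" "\<Gamma> \<turnstile> N \<Colon> C"
  shows "is_prop \<Delta>' (lift n M) \<longleftrightarrow> is_prop \<Delta> M"
proof -
  obtain k where "\<Gamma> \<turnstile> C \<Colon> Type k" using type_correctness[OF assms(2)] by blast
  from weakening[OF _ assms(1) this, of M Prop] strengthening[OF assms, of M Prop]
  show ?thesis by (auto simp: is_prop_def)
qed

text \<open>From the larger context to the smaller one, the proposition being proved may mention the
  inserted variable, so the inhabitant is substituted in it as well.\<close>

lemma is_proof_lift_iff: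
  assumes "ctx_ins C \<Gamma> n \<Delta> \<Delta>'" "\<Gamma> \<turnstile> N \<Colon> C"
  shows "is_proof \<Delta>' (lift n M) \<longleftrightarrow> is_proof \<Delta> M"
proof
  assume "is_proof \<Delta>' (lift n M)"
  then obtain P where "\<Delta>' \<turnstile> P \<Colon> Prop" "\<Delta>' \<turnstile> lift n M \<Colon> P" by (auto simp: is_proof_def is_prop_def)
  with substitution[OF this(1) ctx_ins_imp_ctx_sub[OF assms]] strengthening[OF assms this(2)]
  show "is_proof \<Delta> M" by (auto simp: is_proof_def is_prop_def)
next
  obtain k where "\<Gamma> \<turnstile> C \<Colon> Type k" using type_correctness[OF assms(2)] by blast
  note w = weakening[OF _ assms(1) this]
  assume "is_proof \<Delta> M"
  then show "is_proof \<Delta>' (lift n M)" using w[of _ Prop] w[of M] by (auto simp: is_proof_def is_prop_def)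
qed

section \<open>Unfolding the interpretation, and its invariance under inserting a variable\<close>

lemma interp_Var: "\<not> is_proof \<Gamma> (Var i) \<Longrightarrow>
   interp X p \<Gamma> (Var i) \<gamma> = (if i < length \<gamma> then Some (\<gamma> ! i) else None)"
  by (simp add: interp.simps[of X p \<Gamma> "Var i" \<gamma>])

lemma interp_Prop: "interp X p \<Gamma> Prop \<gamma> = Some (vset (vset ` {U. openin X U}))"
  by (simp add: interp.simps[of X p \<Gamma> Prop \<gamma>])

lemma interp_Type: "\<not> is_proof \<Gamma> (Type j) \<Longrightarrow> interp X p \<Gamma> (Type j) \<gamma> = Some (univ j)"
  by (simp add: interp.simps[of X p \<Gamma> "Type j" \<gamma>])

lemma interp_Prod_proposition:
  "is_prop (P # \<Gamma>) Q \<Longrightarrow> is_prop \<Gamma> P \<Longrightarrow> interp X p \<Gamma> (Prod P Q) \<gamma> =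
     (if occurs 0 Q then None
      else do {
        a \<leftarrow> interp X p \<Gamma> P \<gamma> \<bind> as_open X;
        b \<leftarrow> interp X p \<Gamma> (unlift Q) \<gamma> \<bind> as_open X;
        Some (vset (expo X b a))
      })"
  by (simp add: interp.simps[of X p \<Gamma> "Prod P Q" \<gamma>])

lemma interp_Prod_forall:
  "is_prop (P # \<Gamma>) Q \<Longrightarrow> \<not> is_prop \<Gamma> P \<Longrightarrow> interp X p \<Gamma> (Prod P Q) \<gamma> =
     do {
       a \<leftarrow> interp X p \<Gamma> P \<gamma>;
       q \<leftarrow> family (elts a) (\<lambda>\<alpha>. interp X p (P # \<Gamma>) Q (\<alpha> # \<gamma>) \<bind> as_open X);
       Some (vset (meet X (q ` elts a)))
     }"
  by (simp add: interp.simps[of X p \<Gamma> "Prod P Q" \<gamma>])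

lemma interp_Prod_set:
  "\<not> is_prop (P # \<Gamma>) Q \<Longrightarrow> interp X p \<Gamma> (Prod P Q) \<gamma> =
     do {
       a \<leftarrow> interp X p \<Gamma> P \<gamma>;
       q \<leftarrow> family (dom_of p \<Gamma> P a) (\<lambda>\<alpha>. interp X p (P # \<Gamma>) Q (\<alpha> # \<gamma>));
       Some (vProd (dom_of p \<Gamma> P a) q)
     }"
  by (simp add: interp.simps[of X p \<Gamma> "Prod P Q" \<gamma>])

lemma interp_App: "\<not> is_proof \<Gamma> (App M N) \<Longrightarrow>
   interp X p \<Gamma> (App M N) \<gamma> = do { f \<leftarrow> interp X p \<Gamma> M \<gamma>; a \<leftarrow> interp X p \<Gamma> N \<gamma>; vapp f a }"
  by (simp add: interp.simps[of X p \<Gamma> "App M N" \<gamma>])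

text \<open>Insertion changes none of the tests \<open>is_prop\<close>, \<open>is_proof\<close> and
  \<open>occurs 0\<close>, so both sides take the same branches. The induction is on the size
  because \<open>unlift Q\<close> is no subterm of the product it comes from.\<close>

theorem interp_lift:
  assumes "ctx_ins C \<Gamma> n \<Delta> \<Delta>'" "\<Gamma> \<turnstile> N \<Colon> C" "length \<delta> = n"
  shows "interp X p \<Delta>' (lift n M) (\<delta> @ c # \<gamma>) = interp X p \<Delta> M (\<delta> @ \<gamma>)"
  using assms
proof (induction "size M" arbitrary: M n \<Delta> \<Delta>' \<delta> rule: less_induct)
  case less
  note ins = less.prems(1) and N = less.prems(2) and len = less.prems(3)
  note is_prop_eq = is_prop_lift_iff[OF ins N]
  have is_prop_Suc: "is_prop (lift n A # \<Delta>') (lift (Suc n) B) \<longleftrightarrow> is_prop (A # \<Delta>) B" for A B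
    by (rule is_prop_lift_iff[OF ins_Suc[OF ins] N])
  have dom: "dom_of p \<Delta>' (lift n A) a = dom_of p \<Delta> A a" for A a
    by (simp add: dom_of_def is_prop_eq)
  have dom_Suc: "dom_of p (lift n A # \<Delta>') (lift (Suc n) B) b = dom_of p (A # \<Delta>) B b" for A B b
    by (simp add: dom_of_def is_prop_Suc)
  have IH: "interp X p \<Delta>' (lift n K) (\<delta> @ c # \<gamma>) = interp X p \<Delta> K (\<delta> @ \<gamma>)" if "size K < size M" for K
    using less.hyps[OF that ins N len] .
  have IH_Suc: "interp X p (lift n A # \<Delta>') (lift (Suc n) K) (\<alpha> # \<delta> @ c # \<gamma>)
      = interp X p (A # \<Delta>) K (\<alpha> # \<delta> @ \<gamma>)" if "size K < size M" for A K \<alpha>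
    using less.hyps[OF that ins_Suc[OF ins] N, of "\<alpha> # \<delta>"] len by simp
  show ?case
  proof (cases "is_proof \<Delta> M")
    case True
    then show ?thesis using is_proof_lift_iff[OF ins N, of M] by (simp add: interp.simps)
  next
    case False
    then have np: "\<not> is_proof \<Delta>' (lift n M)" using is_proof_lift_iff[OF ins N, of M] by simp
    show ?thesis
    proof (cases M)
      case (Var i)
      then show ?thesis using False np len by (auto simp: interp_Var nth_append)
    next
      case (Prod P Q)
      \<comment> \<open>The induction hypothesis applies since \<open>unlift Q\<close> has the same
        size as \<open>Q\<close>.\<close>
      have u: "interp X p \<Delta>' (unlift (lift (Suc n) Q)) (\<delta> @ c # \<gamma>) = interp X p \<Delta> (unlift Q) (\<delta> @ \<gamma>)"
        unfolding unlift_lift_Suc by (rule IH) (simp add: Prod unlift_def)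
      have [simp]: "size P < size M" "size Q < size M" by (simp_all add: Prod)
      show ?thesis
        unfolding Prod lift.simps
        by (cases "is_prop (P # \<Delta>) Q"; cases "is_prop \<Delta> P")
          (simp_all add: interp_Prod_proposition interp_Prod_forall interp_Prod_set
            is_prop_eq is_prop_Suc dom u IH IH_Suc)
    next
      case (Lam A K)
      have [simp]: "size A < size M" "size K < size M" by (simp_all add: Lam)
      show ?thesis
        using False np
        by (simp add: Lam interp.simps[of X p _ "Lam _ _"] dom IH IH_Suc)
    next
      case (App K L)
      have [simp]: "size K < size M" "size L < size M" by (simp_all add: App)
      show ?thesis using False np by (simp add: App interp_App IH)
    next
      case (Sig A B)
      have [simp]: "size A < size M" "size B < size M" by (simp_all add: Sig)
      show ?thesis
        using False np
        by (simp add: Sig interp.simps[of X p _ "Sig _ _"] dom dom_Suc IH IH_Suc)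
    next
      case (MkPair S K L)
      have [simp]: "size K < size M" "size L < size M" by (simp_all add: MkPair)
      show ?thesis using False np by (simp add: MkPair interp.simps[of X p _ "MkPair _ _ _"] IH)
    next
      case (Proj1 K)
      have [simp]: "size K < size M" by (simp add: Proj1)
      show ?thesis using False np by (simp add: Proj1 interp.simps[of X p _ "Proj1 _"] IH)
    next
      case (Proj2 K)
      have [simp]: "size K < size M" by (simp add: Proj2)
      show ?thesis using False np by (simp add: Proj2 interp.simps[of X p _ "Proj2 _"] IH)
    qed (use False np in \<open>simp_all add: interp_Prop interp_Type\<close>)
  qed
qed

lemma interp_lift_0:
  assumes "\<Gamma> \<turnstile> N \<Colon> C"
  shows "interp X p (C # \<Gamma>) (lift 0 M) (c # \<gamma>) = interp X p \<Gamma> M \<gamma>"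
  using interp_lift[OF ins_0 assms, of "[]"] by simp

lemma interp_lift_1:
  assumes "\<Gamma> \<turnstile> N \<Colon> C"
  shows "interp X p (lift 0 A # C # \<Gamma>) (lift 1 M) (\<alpha> # c # \<gamma>) = interp X p (A # \<Gamma>) M (\<alpha> # \<gamma>)"
  using interp_lift[OF ins_Suc[OF ins_0] assms, of "[\<alpha>]"] by simp


section \<open>Small sets\<close>

definition small :: "'v::zf_universes set \<Rightarrow> bool" where
  "small S \<longleftrightarrow> (\<exists>c. elts c = S)"

lemma small_elts [simp]: "small (elts a)"
  by (auto simp: small_def)

lemma elts_vset [simp]: "small S \<Longrightarrow> elts (vset S) = S"
  unfolding small_def vset_def by (metis f_inv_into_f rangeI)

lemma vset_elts [simp]: "vset (elts a) = a"
  by (rule extensionality) simp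

lemma small_subset: "S \<subseteq> T \<Longrightarrow> small T \<Longrightarrow> small S"
proof -
  assume "S \<subseteq> T" "small T"
  then obtain a where a: "elts a = T" by (auto simp: small_def)
  from separation[of a "\<lambda>b. b \<in> S"] obtain c where "elts c = {b \<in> elts a. b \<in> S}" by blast
  with a \<open>S \<subseteq> T\<close> show ?thesis by (auto simp: small_def intro!: exI[of _ c])
qed

lemma small_image:
  fixes F :: "'v::zf_universes \<Rightarrow> 'v"
  shows "small S \<Longrightarrow> small (F ` S)"
proof -
  assume "small S"
  then obtain a where "elts a = S" by (auto simp: small_def)
  with replacement[of F a] show ?thesis by (simp add: small_def)
qed

text \<open>The union axiom speaks about members of a set, so the family is first coded as a set by
  replacement.\<close>

lemma small_UN:
  fixes F :: "'v::zf_universes \<Rightarrow> 'v set"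
  shows "small S \<Longrightarrow> (\<And>a. a \<in> S \<Longrightarrow> small (F a)) \<Longrightarrow> small (\<Union>a\<in>S. F a)"
proof -
  assume "small S" and F: "\<And>a. a \<in> S \<Longrightarrow> small (F a)"
  then have "small ((\<lambda>a. vset (F a)) ` S)" by (intro small_image)
  then obtain c where c: "elts c = (\<lambda>a. vset (F a)) ` S" by (auto simp: small_def)
  from union[of c] obtain d where d: "elts d = \<Union> (elts ` elts c)" by blast
  have "elts d = (\<Union>a\<in>S. F a)" using F by (auto simp: d c)
  then show ?thesis by (auto simp: small_def)
qed

lemma small_vset_Pow: "small S \<Longrightarrow> small (vset ` Pow S)"
proof -
  assume "small S"
  then obtain a where a: "elts a = S" by (auto simp: small_def)
  from powerset[of a] obtain c where c: "elts c = {b. elts b \<subseteq> elts a}" by blast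
  have "vset ` Pow S \<subseteq> elts c"
  proof (rule image_subsetI)
    fix T assume "T \<in> Pow S"
    with small_subset[of T S] \<open>small S\<close> show "vset T \<in> elts c" by (simp add: c a)
  qed
  then show ?thesis by (rule small_subset) simp
qed

section \<open>Ordered pairs, graphs and function spaces as sets\<close>

lemma small_doubleton: "small {a, b}"
  using pairing[of a b] by (simp add: small_def)

lemma small_singleton: "small {a}"
  using small_doubleton[of a a] by simp

lemma vpair_eq_iff: "vpair a b = vpair c d \<longleftrightarrow> a = c \<and> b = d"
proof -
  have inj: "vset S = vset T \<longleftrightarrow> S = T" if "small S" "small T" for S T :: "'a set"
    using elts_vset[OF that(1)] elts_vset[OF that(2)] by metis
  show ?thesis
    unfolding vpair_def by (auto simp: inj small_doubleton small_singleton doubleton_eq_iff)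
qed

lemma small_pairs: "small D \<Longrightarrow> small E \<Longrightarrow> small {vpair a b |a b. a \<in> D \<and> b \<in> E}"
proof -
  assume "small D" "small E"
  then have "small (\<Union>a\<in>D. vpair a ` E)" by (intro small_UN small_image)
  moreover have "(\<Union>a\<in>D. vpair a ` E) = {vpair a b |a b. a \<in> D \<and> b \<in> E}" by auto
  ultimately show ?thesis by simp
qed

lemma elts_vgraph: "small D \<Longrightarrow> elts (vgraph D f) = (\<lambda>a. vpair a (f a)) ` D"
  unfolding vgraph_def by (intro elts_vset small_image)

lemma vapp_vgraph: "small D \<Longrightarrow> vapp (vgraph D f) a = (if a \<in> D then Some (f a) else None)"
  by (auto simp: vapp_def elts_vgraph vpair_eq_iff image_iff)

text \<open>Every graph is a subset of the product of \<open>D\<close> and \<open>elts b\<close>, so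
  powerset and separation make the collection of graphs small.\<close>

lemma elts_vProd_const:
  assumes "small D"
  shows "elts (vProd D (\<lambda>_. b)) = {vgraph D f |f. \<forall>a\<in>D. f a \<in> elts b}"
  unfolding vProd_def
proof (rule elts_vset, rule small_subset)
  show "small (vset ` Pow {vpair a c |a c. a \<in> D \<and> c \<in> elts b})"
    by (intro small_vset_Pow small_pairs assms small_elts)
  show "{vgraph D f |f. \<forall>a\<in>D. f a \<in> elts b} \<subseteq> vset ` Pow {vpair a c |a c. a \<in> D \<and> c \<in> elts b}"
    unfolding vgraph_def by blast
qed


section \<open>The Heyting algebra of open sets\<close>

lemma openin_expo [simp]: "openin X (expo X b a)"
  unfolding expo_def by (rule openin_Union) auto

lemma expo_elim: "t \<in> expo X b a \<Longrightarrow> t \<in> a \<Longrightarrow> t \<in> b"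
  unfolding expo_def by blast

text \<open>With \<open>expo_elim\<close> this is the adjunction between intersection and
  exponential, the only way in which exponentials are used below.\<close>

lemma expo_intro: "openin X t \<Longrightarrow> t \<inter> a \<subseteq> b \<Longrightarrow> t \<subseteq> expo X b a"
  unfolding expo_def by blast

lemma expo_eq_topspace: "openin X a \<Longrightarrow> a \<subseteq> b \<Longrightarrow> expo X b a = topspace X"
  by (intro antisym openin_subset openin_expo expo_intro) auto

lemma expo_of_topspace: "expo X b (topspace X) \<subseteq> b"
  using openin_subset[OF openin_expo[of X b "topspace X"]] by (blast dest: expo_elim)

lemma openin_meet [simp]: "openin X (meet X S)"
  by (simp add: meet_def)

lemma meet_lower: "b \<in> S \<Longrightarrow> meet X S \<subseteq> b"
  using interior_of_subset[of X "\<Inter> S"] by (auto simp: meet_def)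

lemma meet_greatest: "openin X t \<Longrightarrow> (\<And>b. b \<in> S \<Longrightarrow> t \<subseteq> b) \<Longrightarrow> t \<subseteq> meet X S"
  by (cases "S = {}") (simp_all add: meet_def openin_subset interior_of_maximal Inter_greatest)

text \<open>The scheme for all impredicative encodings: \<open>t\<close> is a lower bound of the
  family, and the instance \<open>b\<close> brings the meet below \<open>t\<close>.\<close>

lemma meet_eqI:
  "openin X t \<Longrightarrow> (\<And>b. b \<in> S \<Longrightarrow> t \<subseteq> b) \<Longrightarrow> b \<in> S \<Longrightarrow> b \<subseteq> t \<Longrightarrow> meet X S = t"
  using meet_lower[of b S X] meet_greatest[of X t S] by blast

lemma meet_Bot: "meet X {U. openin X U} = {}"
  by (rule meet_eqI[of _ _ _ "{}"]) auto

lemma meet_Conj: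
  assumes "openin X a" "openin X b"
  shows "meet X ((\<lambda>U. expo X U (expo X (expo X U b) a)) ` {U. openin X U}) = a \<inter> b"
proof (rule meet_eqI)
  show "openin X (a \<inter> b)" using assms by blast
  show "a \<inter> b \<subseteq> c" if "c \<in> (\<lambda>U. expo X U (expo X (expo X U b) a)) ` {U. openin X U}" for c
    using that assms by (auto intro!: subsetD[OF expo_intro[of X "a \<inter> b"]] dest: expo_elim)
  \<comment> \<open>At the instance \<open>U = a \<inter> b\<close> the premise of the encoding is
    the whole space, and an exponential with exponent \<open>topspace X\<close> lies below its
    base.\<close>
  have "a \<subseteq> expo X (a \<inter> b) b" using assms by (intro expo_intro) auto
  then have "expo X (expo X (a \<inter> b) b) a = topspace X"
    using assms by (intro expo_eq_topspace) auto
  then show "expo X (a \<inter> b) (expo X (expo X (a \<inter> b) b) a) \<subseteq> a \<inter> b"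
    by (simp only: expo_of_topspace)
  show "expo X (a \<inter> b) (expo X (expo X (a \<inter> b) b) a)
      \<in> (\<lambda>U. expo X U (expo X (expo X U b) a)) ` {U. openin X U}"
    using assms by blast
qed

lemma meet_Disj:
  assumes "openin X a" "openin X b"
  shows "meet X ((\<lambda>U. expo X (expo X U (expo X U b)) (expo X U a)) ` {U. openin X U}) = a \<union> b"
proof (rule meet_eqI)
  show "openin X (a \<union> b)" using assms by blast
  show "a \<union> b \<subseteq> c"
    if c: "c \<in> (\<lambda>U. expo X (expo X U (expo X U b)) (expo X U a)) ` {U. openin X U}" for c
  proof -
    from c obtain U where "openin X U" and c: "c = expo X (expo X U (expo X U b)) (expo X U a)" by blast
    have "(a \<union> b) \<inter> expo X U a \<subseteq> expo X U (expo X U b)"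
      using assms by (intro expo_intro) (auto dest: expo_elim)
    then show ?thesis unfolding c by (rule expo_intro[rotated]) (use assms in blast)
  qed
  \<comment> \<open>At the instance \<open>U = a \<union> b\<close> both premises are the whole
    space.\<close>
  have "expo X (a \<union> b) a = topspace X" "expo X (a \<union> b) b = topspace X"
    using assms by (blast intro!: expo_eq_topspace)+
  then show "expo X (expo X (a \<union> b) (expo X (a \<union> b) b)) (expo X (a \<union> b) a) \<subseteq> a \<union> b"
    by (simp only: order_trans[OF expo_of_topspace expo_of_topspace])
  show "expo X (expo X (a \<union> b) (expo X (a \<union> b) b)) (expo X (a \<union> b) a)
      \<in> (\<lambda>U. expo X (expo X U (expo X U b)) (expo X U a)) ` {U. openin X U}"
    using assms by blast
qed

lemma meet_Exi:
  assumes "\<And>i. i \<in> I \<Longrightarrow> openin X (q i)"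
  shows "meet X ((\<lambda>U. expo X U (meet X ((\<lambda>i. expo X U (q i)) ` I))) ` {U. openin X U}) = (\<Union>i\<in>I. q i)"
    (is "meet X (?F ` _) = ?q")
proof (rule meet_eqI)
  show q: "openin X ?q" using assms by blast
  show "?q \<subseteq> c" if "c \<in> ?F ` {U. openin X U}" for c
  proof -
    from that obtain U where U: "openin X U" "c = ?F U" by blast
    have "meet X ((\<lambda>i. expo X U (q i)) ` I) \<subseteq> expo X U (q i)" if "i \<in> I" for i
      using that by (intro meet_lower) blast
    then have "?q \<inter> meet X ((\<lambda>i. expo X U (q i)) ` I) \<subseteq> U" by (blast dest: expo_elim)
    then show ?thesis unfolding U using q by (intro expo_intro)
  qed
  \<comment> \<open>At the instance where \<open>U\<close> is the union, all members of the inner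
    meet are the whole space. For \<open>I = {}\<close> the convention for the empty meet gives the
    same result.\<close>
  have "expo X ?q (q i) = topspace X" if "i \<in> I" for i
    using assms that by (intro expo_eq_topspace) auto
  then have "topspace X \<subseteq> meet X ((\<lambda>i. expo X ?q (q i)) ` I)"
    by (intro meet_greatest) auto
  then have "meet X ((\<lambda>i. expo X ?q (q i)) ` I) = topspace X"
    by (intro antisym openin_subset openin_meet)
  then show "?F ?q \<subseteq> ?q" by (simp only: expo_of_topspace)
  show "?F ?q \<in> ?F ` {U. openin X U}" using q by blast
qed


section \<open>Typing of the logical symbols\<close>

lemma is_prop_Imp: "is_prop \<Gamma> A \<Longrightarrow> is_prop \<Gamma> B \<Longrightarrow> is_prop \<Gamma> (Imp A B)"
  unfolding is_prop_def Imp_def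
  using weakening_0[of \<Gamma> B Prop A] Prop_imp_Type by (auto intro: typing.Prod_Prop)

lemma is_prop_lift: "is_prop \<Gamma> A \<Longrightarrow> \<Gamma> \<turnstile> C \<Colon> Type k \<Longrightarrow> is_prop (C # \<Gamma>) (lift 0 A)"
  unfolding is_prop_def using weakening_0[of \<Gamma> A Prop] by simp

lemma is_prop_Var: "valid_ctx \<Gamma> \<Longrightarrow> i < length \<Gamma> \<Longrightarrow> lookup \<Gamma> i = Prop \<Longrightarrow> is_prop \<Gamma> (Var i)"
  unfolding is_prop_def valid_ctx_def using Var_lookup by metis

lemma valid_ctx_Prop: "valid_ctx \<Gamma> \<Longrightarrow> valid_ctx (Prop # \<Gamma>)"
  unfolding valid_ctx_def by (rule typing.Ext)

text \<open>Also the witness that \<open>Prop\<close> is inhabited over every valid context, as the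
  invariance under insertion requires.\<close>

lemma Bot_typing: "valid_ctx \<Gamma> \<Longrightarrow> \<Gamma> \<turnstile> Bot \<Colon> Prop"
  unfolding Bot_def using is_prop_Var[OF valid_ctx_Prop, of \<Gamma> 0]
  by (auto simp: is_prop_def intro: typing.Prod_Prop)


section \<open>Values of propositions\<close>

lemma interp_open_openin: "interp_open X p \<Gamma> A \<gamma> = Some a \<Longrightarrow> openin X a"
  by (auto simp: interp_open_def as_open_def split: Option.bind_splits if_splits)

lemma interp_open_SomeD: "interp_open X p \<Gamma> A \<gamma> = Some a \<Longrightarrow> interp X p \<Gamma> A \<gamma> = Some (vset a)"
  by (auto simp: interp_open_def as_open_def split: Option.bind_splits if_splits)

context
  fixes X :: "'v::zf_universes topology" and x :: 'v
  assumes X_small: "topspace X = elts x"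
begin

text \<open>Open sets are subsets of the set \<open>x\<close>, hence small, so \<open>vset\<close>
  codes them faithfully.\<close>

lemma elts_open: "openin X U \<Longrightarrow> elts (vset U) = U"
  using openin_subset[of X U] X_small by (intro elts_vset small_subset[of U "elts x"]) auto

lemma as_open_vset: "openin X U \<Longrightarrow> as_open X (vset U) = Some U"
  by (simp add: as_open_def elts_open)

lemma elts_opens: "elts (vset (vset ` {U. openin X U})) = vset ` {U. openin X U}"
proof (rule elts_vset, rule small_subset)
  show "vset ` {U. openin X U} \<subseteq> vset ` Pow (elts x)"
    using openin_subset X_small by blast
qed (intro small_vset_Pow small_elts)

text \<open>The conclusion of an implication is a lifted term, so it does not contain the proof
  variable and the undefined branch of \<open>interp\<close> is avoided.\<close>

lemma interp_open_Imp:
  assumes "is_prop \<Gamma> A" "is_prop \<Gamma> B"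
  shows "interp_open X p \<Gamma> (Imp A B) \<gamma> =
    do { a \<leftarrow> interp_open X p \<Gamma> A \<gamma>; b \<leftarrow> interp_open X p \<Gamma> B \<gamma>; Some (expo X b a) }"
proof -
  have "is_prop (A # \<Gamma>) (lift 0 B)"
    using assms by (intro is_prop_lift[of _ _ _ 0]) (auto simp: is_prop_def intro: Prop_imp_Type)
  with assms(1) show ?thesis
    by (simp add: interp_open_def Imp_def interp_Prod_proposition as_open_vset split: Option.bind_split)
qed

lemma interp_open_forall:
  assumes "is_prop (A # \<Gamma>) Q" "\<not> is_prop \<Gamma> A"
  shows "interp_open X p \<Gamma> (Prod A Q) \<gamma> =
    do {
      a \<leftarrow> interp X p \<Gamma> A \<gamma>;
      q \<leftarrow> family (elts a) (\<lambda>\<alpha>. interp_open X p (A # \<Gamma>) Q (\<alpha> # \<gamma>));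
      Some (meet X (q ` elts a))
    }"
  using assms
  by (simp add: interp_open_def interp_Prod_forall as_open_vset split: Option.bind_split)

lemma interp_open_forall_Prop:
  assumes "is_prop (Prop # \<Gamma>) Q"
    and "\<And>U. openin X U \<Longrightarrow> interp_open X p (Prop # \<Gamma>) Q (vset U # \<gamma>) = Some (F U)"
  shows "interp_open X p \<Gamma> (Prod Prop Q) \<gamma> = Some (meet X (F ` {U. openin X U}))"
  using assms
  by (auto simp: interp_open_forall interp_Prop elts_opens family_def image_image
      intro!: arg_cong[of _ _ "meet X"] image_cong)

text \<open>The range of the bound proposition is nonempty because \<open>{}\<close> is open, so
  undefinedness passes to the product. This gives the equations for the connectives where a
  component has no value.\<close>

lemma interp_open_forall_Prop_None:
  assumes "is_prop (Prop # \<Gamma>) Q"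
    and "\<And>U. openin X U \<Longrightarrow> interp_open X p (Prop # \<Gamma>) Q (vset U # \<gamma>) = None"
  shows "interp_open X p \<Gamma> (Prod Prop Q) \<gamma> = None"
  using assms openin_empty[of X]
  by (auto simp: interp_open_forall interp_Prop elts_opens family_def simp del: openin_empty)

lemma interp_open_Var:
  assumes "lookup \<Gamma> i = Prop" "i < length \<gamma>" "\<gamma> ! i = vset U" "openin X U"
  shows "interp_open X p \<Gamma> (Var i) \<gamma> = Some U"
  using assms by (simp add: interp_open_def interp_Var Var_Prop_not_proof as_open_vset)

lemma interp_open_lift_0:
  "\<Gamma> \<turnstile> N \<Colon> C \<Longrightarrow> interp_open X p (C # \<Gamma>) (lift 0 M) (c # \<gamma>) = interp_open X p \<Gamma> M \<gamma>"
  by (simp add: interp_open_def interp_lift_0)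

section \<open>Values of falsity, conjunction, disjunction and existential quantification\<close>

lemma interp_open_Bot:
  assumes "valid_ctx \<Gamma>"
  shows "interp_open X p \<Gamma> Bot \<gamma> = Some {}"
proof -
  have "interp_open X p \<Gamma> (Prod Prop (Var 0)) \<gamma> = Some (meet X ((\<lambda>U. U) ` {U. openin X U}))"
    using assms by (intro interp_open_forall_Prop interp_open_Var is_prop_Var valid_ctx_Prop) auto
  then show ?thesis by (simp add: Bot_def meet_Bot)
qed

lemma interp_open_Conj:
  assumes v: "valid_ctx \<Gamma>" and A: "is_prop \<Gamma> A" and B: "is_prop \<Gamma> B"
  shows "interp_open X p \<Gamma> (Conj A B) \<gamma> =
    do { a \<leftarrow> interp_open X p \<Gamma> A \<gamma>; b \<leftarrow> interp_open X p \<Gamma> B \<gamma>; Some (a \<inter> b) }"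
proof -
  note Bot = Bot_typing[OF v]
  have props: "is_prop (Prop # \<Gamma>) (lift 0 A)" "is_prop (Prop # \<Gamma>) (lift 0 B)" "is_prop (Prop # \<Gamma>) (Var 0)"
    using A B v by (auto simp: valid_ctx_def intro: is_prop_lift is_prop_Var[OF valid_ctx_Prop[OF v]])
  let ?Q = "Imp (Imp (lift 0 A) (Imp (lift 0 B) (Var 0))) (Var 0)"
  have Q: "is_prop (Prop # \<Gamma>) ?Q" using props by (intro is_prop_Imp)
  \<comment> \<open>The bound proposition takes the value \<open>U\<close>, while \<open>A\<close>
    and \<open>B\<close> keep their values because \<open>Bot\<close> inhabits the type of the
    inserted variable.\<close>
  have val: "interp_open X p (Prop # \<Gamma>) ?Q (vset U # \<gamma>) =
      do { a \<leftarrow> interp_open X p \<Gamma> A \<gamma>; b \<leftarrow> interp_open X p \<Gamma> B \<gamma>;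
           Some (expo X U (expo X (expo X U b) a)) }" if "openin X U" for U
    using that props
    by (simp add: interp_open_Imp is_prop_Imp interp_open_lift_0[OF Bot] interp_open_Var
        split: Option.bind_split)
  show ?thesis
  proof (cases "interp_open X p \<Gamma> A \<gamma>")
    case None
    then show ?thesis unfolding Conj_def using interp_open_forall_Prop_None[OF Q] val by simp
  next
    case a: (Some a)
    show ?thesis
    proof (cases "interp_open X p \<Gamma> B \<gamma>")
      case None
      with a show ?thesis unfolding Conj_def using interp_open_forall_Prop_None[OF Q] val by simp
    next
      case b: (Some b)
      from interp_open_forall_Prop[OF Q, of p \<gamma> "\<lambda>U. expo X U (expo X (expo X U b) a)"] a b val
      show ?thesis
        unfolding Conj_def by (simp add: meet_Conj interp_open_openin[OF a] interp_open_openin[OF b])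
    qed
  qed
qed

lemma interp_open_Disj:
  assumes v: "valid_ctx \<Gamma>" and A: "is_prop \<Gamma> A" and B: "is_prop \<Gamma> B"
  shows "interp_open X p \<Gamma> (Disj A B) \<gamma> =
    do { a \<leftarrow> interp_open X p \<Gamma> A \<gamma>; b \<leftarrow> interp_open X p \<Gamma> B \<gamma>; Some (a \<union> b) }"
proof -
  note Bot = Bot_typing[OF v]
  have props: "is_prop (Prop # \<Gamma>) (lift 0 A)" "is_prop (Prop # \<Gamma>) (lift 0 B)" "is_prop (Prop # \<Gamma>) (Var 0)"
    using A B v by (auto simp: valid_ctx_def intro: is_prop_lift is_prop_Var[OF valid_ctx_Prop[OF v]])
  let ?Q = "Imp (Imp (lift 0 A) (Var 0)) (Imp (Imp (lift 0 B) (Var 0)) (Var 0))"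
  have Q: "is_prop (Prop # \<Gamma>) ?Q" using props by (intro is_prop_Imp)
  have val: "interp_open X p (Prop # \<Gamma>) ?Q (vset U # \<gamma>) =
      do { a \<leftarrow> interp_open X p \<Gamma> A \<gamma>; b \<leftarrow> interp_open X p \<Gamma> B \<gamma>;
           Some (expo X (expo X U (expo X U b)) (expo X U a)) }" if "openin X U" for U
    using that props
    by (simp add: interp_open_Imp is_prop_Imp interp_open_lift_0[OF Bot] interp_open_Var
        split: Option.bind_split)
  show ?thesis
  proof (cases "interp_open X p \<Gamma> A \<gamma>")
    case None
    then show ?thesis unfolding Disj_def using interp_open_forall_Prop_None[OF Q] val by simp
  next
    case a: (Some a)
    show ?thesis
    proof (cases "interp_open X p \<Gamma> B \<gamma>")
      case None
      with a show ?thesis unfolding Disj_def using interp_open_forall_Prop_None[OF Q] val by simp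
    next
      case b: (Some b)
      from interp_open_forall_Prop[OF Q, of p \<gamma> "\<lambda>U. expo X (expo X U (expo X U b)) (expo X U a)"] a b val
      show ?thesis
        unfolding Disj_def by (simp add: meet_Disj interp_open_openin[OF a] interp_open_openin[OF b])
    qed
  qed
qed

lemma interp_open_Exi:
  assumes v: "valid_ctx \<Gamma>" and A: "is_type \<Gamma> A" "\<not> is_prop \<Gamma> A" and Q: "is_prop (A # \<Gamma>) Q"
  shows "interp_open X p \<Gamma> (Exi A Q) \<gamma> =
    do { a \<leftarrow> interp X p \<Gamma> A \<gamma>;
         q \<leftarrow> family (elts a) (\<lambda>\<alpha>. interp_open X p (A # \<Gamma>) Q (\<alpha> # \<gamma>));
         Some (\<Union>\<alpha>\<in>elts a. q \<alpha>) }"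
proof -
  note Bot = Bot_typing[OF v]
  from A(1) obtain j where j: "\<Gamma> \<turnstile> A \<Colon> Type j" by (auto simp: is_type_def)
  have PT: "\<Gamma> \<turnstile> Prop \<Colon> Type 0" using v by (simp add: valid_ctx_def)
  from weakening_0[OF j PT] have j': "Prop # \<Gamma> \<turnstile> lift 0 A \<Colon> Type j" by simp
  then have v': "valid_ctx (lift 0 A # Prop # \<Gamma>)" by (auto simp: valid_ctx_def intro: typing.Ext)
  have nA: "\<not> is_prop (Prop # \<Gamma>) (lift 0 A)" using A(2) is_prop_lift_iff[OF ins_0 Bot] by simp
  have Q': "is_prop (lift 0 A # Prop # \<Gamma>) (lift 1 Q)"
    using Q is_prop_lift_iff[OF ins_Suc[OF ins_0] Bot] by simp
  have V1: "is_prop (lift 0 A # Prop # \<Gamma>) (Var 1)" by (intro is_prop_Var v') auto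
  have V0: "is_prop (Prop # \<Gamma>) (Var 0)" by (intro is_prop_Var valid_ctx_Prop v) auto
  let ?R = "Imp (lift 1 Q) (Var 1)"
  have R: "is_prop (lift 0 A # Prop # \<Gamma>) ?R" using Q' V1 by (rule is_prop_Imp)
  then have R': "is_prop (Prop # \<Gamma>) (Prod (lift 0 A) ?R)"
    by (auto simp: is_prop_def intro: typing.Prod_Prop)
  let ?S = "Imp (Prod (lift 0 A) ?R) (Var 0)"
  have S: "is_prop (Prop # \<Gamma>) ?S" using R' V0 by (rule is_prop_Imp)
  \<comment> \<open>Here the bound proposition is inserted below the quantified variable, so
    \<open>Q\<close> is invariant by insertion at depth 1 and \<open>Var 1\<close> has the value
    \<open>U\<close>.\<close>
  have valR: "interp_open X p (lift 0 A # Prop # \<Gamma>) ?R (\<alpha> # vset U # \<gamma>) =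
      do { q \<leftarrow> interp_open X p (A # \<Gamma>) Q (\<alpha> # \<gamma>); Some (expo X U q) }" if "openin X U" for U \<alpha>
  proof -
    have "interp_open X p (lift 0 A # Prop # \<Gamma>) (lift 1 Q) (\<alpha> # vset U # \<gamma>) =
        interp_open X p (A # \<Gamma>) Q (\<alpha> # \<gamma>)"
      by (simp only: interp_open_def interp_lift_1[OF Bot])
    moreover have "interp_open X p (lift 0 A # Prop # \<Gamma>) (Var 1) (\<alpha> # vset U # \<gamma>) = Some U"
      using that by (intro interp_open_Var) auto
    ultimately show ?thesis by (simp only: interp_open_Imp[OF Q' V1] bind.bind_lunit)
  qed
  have val: "interp_open X p (Prop # \<Gamma>) ?S (vset U # \<gamma>) =
      do { a \<leftarrow> interp X p \<Gamma> A \<gamma>;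
           q \<leftarrow> family (elts a) (\<lambda>\<alpha>. do { q \<leftarrow> interp_open X p (A # \<Gamma>) Q (\<alpha> # \<gamma>); Some (expo X U q) });
           Some (expo X U (meet X (q ` elts a))) }" if "openin X U" for U
  proof -
    have "interp_open X p (Prop # \<Gamma>) (Var 0) (vset U # \<gamma>) = Some U"
      using that by (intro interp_open_Var) auto
    then show ?thesis
      by (simp only: interp_open_Imp[OF R' V0] interp_open_forall[OF R nA] interp_lift_0[OF Bot] valR[OF that])
        simp
  qed
  show ?thesis
  proof (cases "interp X p \<Gamma> A \<gamma>")
    case None
    then show ?thesis unfolding Exi_def using interp_open_forall_Prop_None[OF S] val by simp
  next
    case a: (Some a)
    show ?thesis
    proof (cases "\<exists>\<alpha>\<in>elts a. interp_open X p (A # \<Gamma>) Q (\<alpha> # \<gamma>) = None")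
      case True
      \<comment> \<open>An undefined value of \<open>Q\<close> makes the inner family undefined
        whatever \<open>U\<close> is.\<close>
      then have "family (elts a)
          (\<lambda>\<alpha>. do { q \<leftarrow> interp_open X p (A # \<Gamma>) Q (\<alpha> # \<gamma>); Some (expo X U q) }) = None" for U
        by (auto simp: family_def intro: rev_bexI)
      then have "interp_open X p (Prop # \<Gamma>) ?S (vset U # \<gamma>) = None" if "openin X U" for U
        using val[OF that] a by simp
      from interp_open_forall_Prop_None[OF S this] True a show ?thesis
        unfolding Exi_def by (auto simp: family_def)
    next
      case False
      define q where "q \<alpha> = the (interp_open X p (A # \<Gamma>) Q (\<alpha> # \<gamma>))" for \<alpha>
      have q: "interp_open X p (A # \<Gamma>) Q (\<alpha> # \<gamma>) = Some (q \<alpha>)" if "\<alpha> \<in> elts a" for \<alpha>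
        using False that by (auto simp: q_def)
      have "interp_open X p (Prop # \<Gamma>) ?S (vset U # \<gamma>) =
          Some (expo X U (meet X ((\<lambda>\<alpha>. expo X U (q \<alpha>)) ` elts a)))" if "openin X U" for U
        using val[OF that] a q by (simp add: family_def cong: image_cong)
      from interp_open_forall_Prop[OF S this] meet_Exi[of "elts a" X q] interp_open_openin[OF q]
      have "interp_open X p \<Gamma> (Exi A Q) \<gamma> = Some (\<Union>\<alpha>\<in>elts a. q \<alpha>)" by (simp add: Exi_def)
      with a q show ?thesis by (simp add: family_def)
    qed
  qed
qed

section \<open>Equivalence and Leibniz equality\<close>

lemma interp_open_Iff_topspace:
  assumes "valid_ctx \<Gamma>" "is_prop \<Gamma> A" "is_prop \<Gamma> B"
    and "interp_open X p \<Gamma> (Iff A B) \<gamma> = Some (topspace X)"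
  shows "\<exists>a. interp X p \<Gamma> A \<gamma> = Some a \<and> interp X p \<Gamma> B \<gamma> = Some a"
proof -
  from assms obtain a b where ab: "interp_open X p \<Gamma> A \<gamma> = Some a" "interp_open X p \<Gamma> B \<gamma> = Some b"
    and "expo X b a \<inter> expo X a b = topspace X"
    unfolding Iff_def
    by (auto simp: interp_open_Conj is_prop_Imp interp_open_Imp split: Option.bind_splits)
  moreover have "a \<subseteq> topspace X" "b \<subseteq> topspace X"
    using ab by (auto dest!: interp_open_openin openin_subset)
  \<comment> \<open>Both exponentials contain every point of the space, so each of \<open>a\<close>
    and \<open>b\<close> is contained in the other.\<close>
  ultimately have "a = b" by (blast dest: expo_elim)
  with ab show ?thesis by (auto dest: interp_open_SomeD)
qed

lemma interp_open_Eq_topspace: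
  assumes "topspace X \<noteq> {}" and A: "is_type \<Gamma> A" and M: "\<Gamma> \<turnstile> M \<Colon> A" and N: "\<Gamma> \<turnstile> N \<Colon> A"
    and Eq: "interp_open X p \<Gamma> (Eq A M N) \<gamma> = Some (topspace X)"
  shows "\<exists>a. interp X p \<Gamma> M \<gamma> = Some a \<and> interp X p \<Gamma> N \<gamma> = Some a"
proof -
  from A obtain j where j: "\<Gamma> \<turnstile> A \<Colon> Type j" by (auto simp: is_type_def)
  have AT: "A # \<Gamma> \<turnstile> Prop \<Colon> Type 0" using j by (rule typing.Ext)
  let ?E = "Prod A Prop"
  have E: "\<Gamma> \<turnstile> ?E \<Colon> Type (max j 0)" using j AT by (rule Prod_Type_max)
  \<comment> \<open>The constantly false predicate inhabits \<open>A \<rightarrow> Prop\<close>, so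
    \<open>M\<close> and \<open>N\<close> keep their values when the predicate variable is
    added.\<close>
  have inh: "\<Gamma> \<turnstile> Lam A Bot \<Colon> ?E" using AT by (intro typing.Lam Bot_typing) (simp add: valid_ctx_def)
  have v: "valid_ctx (?E # \<Gamma>)" unfolding valid_ctx_def using E by (rule typing.Ext)
  have V0: "?E # \<Gamma> \<turnstile> Var 0 \<Colon> Prod (lift 0 A) Prop"
    using Var_lookup[of "?E # \<Gamma>" 0] v by (simp add: valid_ctx_def)
  have App: "is_prop (?E # \<Gamma>) (App (Var 0) (lift 0 K))" if "\<Gamma> \<turnstile> K \<Colon> A" for K
    using typing.App[OF V0 weakening_0[OF that E]] by (simp add: is_prop_def)
  let ?M = "App (Var 0) (lift 0 M)" and ?N = "App (Var 0) (lift 0 N)"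
  have Iff: "is_prop (?E # \<Gamma>) (Iff ?M ?N)"
  proof -
    let ?\<Gamma> = "Prop # ?E # \<Gamma>"
    have "is_prop ?\<Gamma> (lift 0 (Imp ?M ?N))" "is_prop ?\<Gamma> (lift 0 (Imp ?N ?M))"
      using v unfolding valid_ctx_def by (intro is_prop_lift[of _ _ _ 0] is_prop_Imp App M N; assumption)+
    moreover have "is_prop ?\<Gamma> (Var 0)" by (intro is_prop_Var valid_ctx_Prop v) auto
    ultimately have "is_prop ?\<Gamma> (Imp (Imp (lift 0 (Imp ?M ?N)) (Imp (lift 0 (Imp ?N ?M)) (Var 0))) (Var 0))"
      by (intro is_prop_Imp)
    then show ?thesis
      unfolding Iff_def Conj_def by (auto simp: is_prop_def intro: typing.Prod_Prop)
  qed
  let ?O = "vset (vset ` {U. openin X U})"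
  from Eq obtain e q where e: "interp X p \<Gamma> ?E \<gamma> = Some e"
    and q: "family (elts e) (\<lambda>\<alpha>. interp_open X p (?E # \<Gamma>) (Iff ?M ?N) (\<alpha> # \<gamma>)) = Some q"
    and top: "meet X (q ` elts e) = topspace X"
    unfolding Eq_def Imp_def
    by (auto simp: interp_open_forall[OF Iff Prod_Prop_not_prop] split: Option.bind_splits)
  \<comment> \<open>A meet equal to the whole space forces every member to be the whole space, so
    the equivalence can be used for each predicate \<open>f\<close> separately.\<close>
  have eqv: "\<exists>c. interp X p (?E # \<Gamma>) ?M (f # \<gamma>) = Some c \<and> interp X p (?E # \<Gamma>) ?N (f # \<gamma>) = Some c"
    if f: "f \<in> elts e" for f
  proof (rule interp_open_Iff_topspace[OF v App[OF M] App[OF N]])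
    have qf: "interp_open X p (?E # \<Gamma>) (Iff ?M ?N) (f # \<gamma>) = Some (q f)"
      using q f by (auto simp: family_def split: if_splits)
    moreover have "q f = topspace X"
      using openin_subset[OF interp_open_openin[OF qf]] meet_lower[of "q f" "q ` elts e" X] top f by blast
    ultimately show "interp_open X p (?E # \<Gamma>) (Iff ?M ?N) (f # \<gamma>) = Some (topspace X)" by simp
  qed
  have val: "interp X p (?E # \<Gamma>) (App (Var 0) (lift 0 K)) (f # \<gamma>) =
      do { k \<leftarrow> interp X p \<Gamma> K \<gamma>; vapp f k }" for K f
    using App_predicate_not_proof[of "?E # \<Gamma>" 0 "lift 0 A"] Var_predicate_not_proof[of "?E # \<Gamma>" 0 "lift 0 A"]
    by (simp add: interp_App interp_Var interp_lift_0[OF inh])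
  from e obtain a where "interp X p \<Gamma> A \<gamma> = Some a" and e': "e = vProd (dom_of p \<Gamma> A a) (\<lambda>_. ?O)"
    by (auto simp: interp_Prod_set interp_Prop family_def split: Option.bind_splits)
  \<comment> \<open>If \<open>A\<close> is a proposition this is cut down to \<open>p\<close>;
    \<open>dom_of\<close> treats both cases uniformly.\<close>
  let ?D = "dom_of p \<Gamma> A a"
  have D: "small ?D" by (rule small_subset[of _ "elts a"]) (auto simp: dom_of_def)
  have graph: "vgraph ?D f \<in> elts e" if "\<And>d. f d \<in> vset ` {U. openin X U}" for f
    unfolding e' elts_vProd_const[OF D] elts_opens using that by blast
  \<comment> \<open>Applying a constant function serves only to show that \<open>M\<close> and
    \<open>N\<close> have values at all.\<close>
  have "vgraph ?D (\<lambda>_. vset {}) \<in> elts e" by (rule graph) auto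
  from eqv[OF this] obtain m n where m: "interp X p \<Gamma> M \<gamma> = Some m" and n: "interp X p \<Gamma> N \<gamma> = Some n"
    unfolding val by (auto split: Option.bind_splits)
  \<comment> \<open>The function that singles out \<open>m\<close>. Since the applications in
    \<open>eqv\<close> are defined, \<open>m\<close> and \<open>n\<close> lie in \<open>?D\<close>,
    and the value at \<open>n\<close> must agree with the value \<open>{}\<close> at
    \<open>m\<close>.\<close>
  have "vgraph ?D (\<lambda>d. if d = m then vset {} else vset (topspace X)) \<in> elts e" by (rule graph) auto
  from eqv[OF this] have "(if n = m then vset {} else vset (topspace X)) = vset {}"
    unfolding val m n by (auto simp: vapp_vgraph[OF D] split: if_splits)
  moreover have "vset (topspace X) \<noteq> vset {}"
    using elts_open[of "topspace X"] elts_open[of "{}"] assms(1) by (metis openin_empty openin_topspace)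
  ultimately have "n = m" by (auto split: if_splits)
  with m n show ?thesis by simp
qed

end

theorem theorem3:
  fixes X :: "'v::zf_universes topology" and p :: 'v and x :: 'v
    and \<Gamma> :: "tm list" and \<gamma> :: "'v list"
  assumes X_is_a_set: "topspace X = elts x"
    and reference_point: "reference_point X p"
    and ctx: "valid_ctx \<Gamma>"
    and env: "\<gamma> \<in> interp_ctx X p \<Gamma>"
  shows "interp_open X p \<Gamma> Bot \<gamma> = Some {}
    \<and> (\<forall>A B. is_prop \<Gamma> A \<longrightarrow> is_prop \<Gamma> B \<longrightarrow>
         interp_open X p \<Gamma> (Conj A B) \<gamma> =
           do { a \<leftarrow> interp_open X p \<Gamma> A \<gamma>; b \<leftarrow> interp_open X p \<Gamma> B \<gamma>; Some (a \<inter> b) })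
    \<and> (\<forall>A B. is_prop \<Gamma> A \<longrightarrow> is_prop \<Gamma> B \<longrightarrow>
         interp_open X p \<Gamma> (Disj A B) \<gamma> =
           do { a \<leftarrow> interp_open X p \<Gamma> A \<gamma>; b \<leftarrow> interp_open X p \<Gamma> B \<gamma>; Some (a \<union> b) })
    \<and> (\<forall>A Q. is_type \<Gamma> A \<longrightarrow> \<not> is_prop \<Gamma> A \<longrightarrow> is_prop (A # \<Gamma>) Q \<longrightarrow>
         interp_open X p \<Gamma> (Exi A Q) \<gamma> =
           do { a \<leftarrow> interp X p \<Gamma> A \<gamma>;
                q \<leftarrow> family (elts a) (\<lambda>\<alpha>. interp_open X p (A # \<Gamma>) Q (\<alpha> # \<gamma>));
                Some (\<Union>\<alpha>\<in>elts a. q \<alpha>) })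
    \<and> (\<forall>A B. is_prop \<Gamma> A \<longrightarrow> is_prop \<Gamma> B \<longrightarrow>
         interp_open X p \<Gamma> (Iff A B) \<gamma> = Some (topspace X) \<longrightarrow>
         (\<exists>a. interp X p \<Gamma> A \<gamma> = Some a \<and> interp X p \<Gamma> B \<gamma> = Some a))
    \<and> (\<forall>A M N. is_type \<Gamma> A \<longrightarrow> \<Gamma> \<turnstile> M \<Colon> A \<longrightarrow> \<Gamma> \<turnstile> N \<Colon> A \<longrightarrow>
         interp_open X p \<Gamma> (Eq A M N) \<gamma> = Some (topspace X) \<longrightarrow>
         (\<exists>a. interp X p \<Gamma> M \<gamma> = Some a \<and> interp X p \<Gamma> N \<gamma> = Some a))"
proof (intro conjI allI impI)
  \<comment> \<open>The reference point keeps the two truth values \<open>{}\<close> and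
    \<open>topspace X\<close> apart, as the argument for equality requires.\<close>
  have nonempty: "topspace X \<noteq> {}" using reference_point by (auto simp: reference_point_def)
  show "\<exists>a. interp X p \<Gamma> M \<gamma> = Some a \<and> interp X p \<Gamma> N \<gamma> = Some a"
    if "is_type \<Gamma> A" "\<Gamma> \<turnstile> M \<Colon> A" "\<Gamma> \<turnstile> N \<Colon> A"
      "interp_open X p \<Gamma> (Eq A M N) \<gamma> = Some (topspace X)" for A M N
    using interp_open_Eq_topspace[OF X_is_a_set nonempty that] .
qed (rule interp_open_Bot[OF X_is_a_set ctx] interp_open_Conj[OF X_is_a_set ctx]
    interp_open_Disj[OF X_is_a_set ctx] interp_open_Exi[OF X_is_a_set ctx]
    interp_open_Iff_topspace[OF X_is_a_set ctx]; assumption)+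

end
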